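(* Let $\mathcal{G}=\{G_n\}_{n\ge0}$ be a restriction-compatible family of graphs, where $G_n$ has vertex set $[n]$. Then the linear embedding $c:\mathbb{K}[\mathcal{G}]\hookrightarrow\mathbb{K}[\mathfrak{S}_\infty]$ commutes with $\Delta$, i.e. $\Delta\circ c=(c\otimes c)\circ\Delta_{\mathcal{G}}$, where $\Delta$ is the coproduct of the Malvenuto-Reutenauer algebra and $\Delta_{\mathcal{G}}$ is the comultiplication on $\mathbb{K}[\mathcal{G}]$. In particular, $\Delta_{\mathcal{G}}$ is coassociative.
   Context: $\mathbb{K}$ is a field, $[n]=\{1,\dots,n\}$. Graphs are simple with finite vertex set contained in $\mathbb{N}$; $G|_I$ is the induced subgraph. A tube is a nonempty vertex set $I$ with $G|_I$ connected; tubes $I,J$ are compatible if nested or $I\cup J$ is not a tube; a maximal tubing is an inclusion-maximal set of pairwise compatible tubes; $\mathrm{MTub}(G)$ is the set of maximal tubings. An ideal of a tubing $\mathcal{X}$ is a union of pairwise disjoint tubes of $\mathcal{X}$ (possibly empty). For $I\subseteq V(G)$, $G/I$ is the graph on $V(G)\setminus I$ in which $\{i,j\}$, $i\neq j$, is an edge if $\{i,j\}\in E(G)$ or there is a tube $J$ of $G|_I$ and $k,l\in J$ with $\{i,k\},\{j,l\}\in E(G)$. Write $\mathrm{Comp}(S)$ for the set of vertex sets of connected components of $G|_S$. For a maximal tubing $\mathcal{X}$ of $G$ put $\mathcal{X}|_I=\bigcup_{J\in\mathcal{X}}\mathrm{Comp}(I\cap J)$, a maximal tubing of $G|_I$; if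 $I$ is an ideal of $\mathcal{X}$ put $\mathcal{X}/I=\{J\setminus I: J\in\mathcal{X},\ J\not\subseteq I\}$, a maximal tubing of $G/I$. $\mathrm{std}$ denotes relabeling the vertices (of a graph, tubing, or word with distinct integer letters) by $1,2,\dots$ in an order-preserving way. $\mathcal{G}$ is restriction-compatible if for all $n$ and all $I\subseteq[n]$, $\mathrm{std}(G_n|_I)$ is a subgraph of $G_{|I|}$ and $\mathrm{std}(G_n/I)$ is a subgraph of $G_{n-|I|}$. For a graph $G$ on $[n]$ and $w=w_1\cdots w_n\in\mathfrak{S}_n$, $\Psi_G(w)=\{X_1,\dots,X_n\}\in\mathrm{MTub}(G)$, where $X_j$ is the vertex set of the connected component of $G|_{\{w_1,\dots,w_j\}}$ containing $w_j$; $\Psi_G$ is surjective onto $\mathrm{MTub}(G)$. If $H,G$ are graphs on $[n]$ with $E(H)\subseteq E(G)$, there is a unique surjection $\Psi_H^G:\mathrm{MTub}(G)\to\mathrm{MTub}(H)$ with $\Psi_H^G\circ\Psi_G=\Psi_H$ (it is induced by coarsening the normal fan of the graph associahedron of $G$ to that of $H$). $\mathbb{K}[\mathcal{G}]$ is the vector space with basis $\{\mathbb{P}_{\mathcal{X}}:\mathcal{X}\in\bigsqcup_n\mathrm{MTub}(G_n)\}$. For $H$ a subgraph of $G$ on the same vertex set $[n]$, and $\mathcal{X}\in\mathrm{MTub}(H)$, $c_H^G(\mathbb{P}_{\mathcal{X}})=\sum\mathbb{P}_{\mathcal{Y}}$ over $\mathcal{Y}\in\mathrm{MTub}(G)$ with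 $\Psi_H^G(\mathcal{Y})=\mathcal{X}$. For $\mathcal{X}\in\mathrm{MTub}(G_n)$, with $G=G_n$, $$\Delta_{\mathcal{G}}(\mathbb{P}_{\mathcal{X}})=\sum_I c_{\mathrm{std}(G|_I)}^{G_{|I|}}(\mathbb{P}_{\mathrm{std}(\mathcal{X}|_I)})\otimes c_{\mathrm{std}(G/I)}^{G_{n-|I|}}(\mathbb{P}_{\mathrm{std}(\mathcal{X}/I)}),$$ the sum over all ideals $I$ of $\mathcal{X}$. The Malvenuto-Reutenauer algebra $\mathbb{K}[\mathfrak{S}_\infty]=\bigoplus_{n\ge0}\mathbb{K}[\mathfrak{S}_n]$ has basis $\{\mathbb{F}_w\}$ and coproduct $\Delta(\mathbb{F}_u)=\sum_{i=0}^n\mathbb{F}_{\mathrm{std}(u_1\cdots u_i)}\otimes\mathbb{F}_{\mathrm{std}(u_{i+1}\cdots u_n)}$ for $u\in\mathfrak{S}_n$. The embedding $c$ is given by $c(\mathbb{P}_{\mathcal{X}})=\sum_{w\in\Psi_{G_n}^{-1}(\mathcal{X})}\mathbb{F}_w$ for $\mathcal{X}\in\mathrm{MTub}(G_n)$. *)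

theory Defs
  imports
    "HOL-Library.Poly_Mapping"
    "HOL-Library.FuncSet"
    "HOL-Combinatorics.Multiset_Permutations"
begin

section \<open>Graphs\<close>

record ugraph =
  verts :: "nat set"
  edges :: "nat set set"

definition simple_graph :: "ugraph \<Rightarrow> bool" where
  "simple_graph G \<longleftrightarrow> finite (verts G) \<and> (\<forall>e\<in>edges G. e \<subseteq> verts G \<and> card e = 2)"

definition subgraph :: "ugraph \<Rightarrow> ugraph \<Rightarrow> bool" where
  "subgraph H G \<longleftrightarrow> verts H \<subseteq> verts G \<and> edges H \<subseteq> edges G"

definition induced :: "ugraph \<Rightarrow> nat set \<Rightarrow> ugraph" where
  "induced G I = \<lparr>verts = verts G \<inter> I, edges = {e \<in> edges G. e \<subseteq> I}\<rparr>"

definition adj_rel :: "ugraph \<Rightarrow> (nat \<times> nat) set" where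
  "adj_rel G = {(i, j). {i, j} \<in> edges G}"

definition graph_connected :: "ugraph \<Rightarrow> bool" where
  "graph_connected G \<longleftrightarrow>
     verts G \<noteq> {} \<and> (\<forall>u\<in>verts G. \<forall>v\<in>verts G. (u, v) \<in> (adj_rel G)\<^sup>*)"

definition component_of :: "ugraph \<Rightarrow> nat \<Rightarrow> nat set" where
  "component_of G u = {v \<in> verts G. (u, v) \<in> (adj_rel G)\<^sup>*}"

definition Comp :: "ugraph \<Rightarrow> nat set \<Rightarrow> nat set set" where
  "Comp G S = component_of (induced G S) ` verts (induced G S)"

section \<open>Tubes and maximal tubings\<close>

definition tube :: "ugraph \<Rightarrow> nat set \<Rightarrow> bool" where
  "tube G I \<longleftrightarrow> I \<noteq> {} \<and> I \<subseteq> verts G \<and> graph_connected (induced G I)"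

definition compatible :: "ugraph \<Rightarrow> nat set \<Rightarrow> nat set \<Rightarrow> bool" where
  "compatible G I J \<longleftrightarrow> I \<subseteq> J \<or> J \<subseteq> I \<or> \<not> tube G (I \<union> J)"

definition tubing :: "ugraph \<Rightarrow> nat set set \<Rightarrow> bool" where
  "tubing G X \<longleftrightarrow> (\<forall>I\<in>X. tube G I) \<and> (\<forall>I\<in>X. \<forall>J\<in>X. compatible G I J)"

definition MTub :: "ugraph \<Rightarrow> nat set set set" where
  "MTub G = {X. tubing G X \<and> (\<forall>Y. tubing G Y \<and> X \<subseteq> Y \<longrightarrow> Y = X)}"

definition ideals :: "nat set set \<Rightarrow> nat set set" where
  "ideals X = {\<Union>D |D. D \<subseteq> X \<and> pairwise disjnt D}"

definition contract :: "ugraph \<Rightarrow> nat set \<Rightarrow> ugraph" where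
  "contract G I = \<lparr>verts = verts G - I,
     edges = {{i, j} |i j. i \<in> verts G - I \<and> j \<in> verts G - I \<and> i \<noteq> j \<and>
        ({i, j} \<in> edges G \<or>
         (\<exists>J k l. tube (induced G I) J \<and> k \<in> J \<and> l \<in> J \<and>
            {i, k} \<in> edges G \<and> {j, l} \<in> edges G))}\<rparr>"

definition restrict_tubing :: "ugraph \<Rightarrow> nat set set \<Rightarrow> nat set \<Rightarrow> nat set set" where
  "restrict_tubing G X I = (\<Union>J\<in>X. Comp G (I \<inter> J))"

definition contract_tubing :: "nat set set \<Rightarrow> nat set \<Rightarrow> nat set set" where
  "contract_tubing X I = {J - I |J. J \<in> X \<and> \<not> J \<subseteq> I}"

section \<open>Standardization\<close>

definition std_label :: "nat set \<Rightarrow> nat \<Rightarrow> nat" where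
  "std_label S x = card {y \<in> S. y \<le> x}"

definition std_graph :: "ugraph \<Rightarrow> ugraph" where
  "std_graph G = \<lparr>verts = std_label (verts G) ` verts G,
                  edges = image (std_label (verts G)) ` edges G\<rparr>"

text \<open>The argument \<open>S\<close> is the vertex set of the graph of which \<open>X\<close> is a tubing.\<close>

definition std_tubing :: "nat set \<Rightarrow> nat set set \<Rightarrow> nat set set" where
  "std_tubing S X = image (std_label S) ` X"

definition std_word :: "nat list \<Rightarrow> nat list" where
  "std_word w = map (std_label (set w)) w"

section \<open>Restriction-compatible families\<close>

definition graph_family :: "(nat \<Rightarrow> ugraph) \<Rightarrow> bool" where
  "graph_family G \<longleftrightarrow> (\<forall>n. simple_graph (G n) \<and> verts (G n) = {1..n})"

definition restriction_compatible :: "(nat \<Rightarrow> ugraph) \<Rightarrow> bool" where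
  "restriction_compatible G \<longleftrightarrow> (\<forall>n. \<forall>I\<subseteq>{1..n}.
     subgraph (std_graph (induced (G n) I)) (G (card I)) \<and>
     subgraph (std_graph (contract (G n) I)) (G (n - card I)))"

section \<open>From permutations to maximal tubings\<close>

text \<open>A permutation in \<open>\<SS>\<^sub>n\<close> is the list \<open>w\<^sub>1 \<dots> w\<^sub>n\<close> of its values, an element of
  \<open>permutations_of_set {1..n}\<close>. List positions start at 0.\<close>

definition Psi :: "ugraph \<Rightarrow> nat list \<Rightarrow> nat set set" where
  "Psi G w = (\<lambda>j. component_of (induced G (set (take (Suc j) w))) (w ! j)) ` {..<length w}"

text \<open>\<open>Psi_coarsen G H\<close> is the map $\Psi_H^G$, for graphs on the same vertex set with
  \<open>edges H \<subseteq> edges G\<close>. Extensionality fixes its irrelevant values outside \<open>MTub G\<close>, so that the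
  defining property determines it uniquely.\<close>

definition Psi_coarsen :: "ugraph \<Rightarrow> ugraph \<Rightarrow> nat set set \<Rightarrow> nat set set" where
  "Psi_coarsen G H = (THE f. f \<in> extensional (MTub G) \<and> f ` MTub G = MTub H \<and>
     (\<forall>w\<in>permutations_of_set (verts G). f (Psi G w) = Psi H w))"

section \<open>Free vector spaces and their tensor products\<close>

text \<open>The vector space with basis \<open>B\<close> consists of the finitely supported functions
  \<open>'a \<Rightarrow>\<^sub>0 'k\<close> with support in \<open>B :: 'a set\<close>. The tensor product of the spaces with
  bases \<open>A\<close> and \<open>B\<close> is the space with basis \<open>A \<times> B\<close>, where \<open>(a, b)\<close> stands for
  the tensor of the basis vectors \<open>a\<close> and \<open>b\<close>.\<close>

definition free_space :: "'a set \<Rightarrow> ('a \<Rightarrow>\<^sub>0 'k::field) set" where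
  "free_space B = {p. Poly_Mapping.keys p \<subseteq> B}"

abbreviation basis_vec :: "'a \<Rightarrow> 'a \<Rightarrow>\<^sub>0 'k::field" where
  "basis_vec a \<equiv> Poly_Mapping.single a 1"

definition scale :: "'k::field \<Rightarrow> ('a \<Rightarrow>\<^sub>0 'k) \<Rightarrow> 'a \<Rightarrow>\<^sub>0 'k" where
  "scale r = Poly_Mapping.map ((*) r)"

definition lin_ext :: "('a \<Rightarrow> 'b \<Rightarrow>\<^sub>0 'k::field) \<Rightarrow> ('a \<Rightarrow>\<^sub>0 'k) \<Rightarrow> 'b \<Rightarrow>\<^sub>0 'k" where
  "lin_ext f p = (\<Sum>a\<in>Poly_Mapping.keys p. scale (Poly_Mapping.lookup p a) (f a))"

definition tensor :: "('a \<Rightarrow>\<^sub>0 'k::field) \<Rightarrow> ('b \<Rightarrow>\<^sub>0 'k) \<Rightarrow> ('a \<times> 'b) \<Rightarrow>\<^sub>0 'k" where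
  "tensor p q = (\<Sum>a\<in>Poly_Mapping.keys p. \<Sum>b\<in>Poly_Mapping.keys q.
     Poly_Mapping.single (a, b) (Poly_Mapping.lookup p a * Poly_Mapping.lookup q b))"

definition tensor_map ::
  "(('a \<Rightarrow>\<^sub>0 'k::field) \<Rightarrow> 'c \<Rightarrow>\<^sub>0 'k) \<Rightarrow> (('b \<Rightarrow>\<^sub>0 'k) \<Rightarrow> 'd \<Rightarrow>\<^sub>0 'k) \<Rightarrow>
   (('a \<times> 'b) \<Rightarrow>\<^sub>0 'k) \<Rightarrow> ('c \<times> 'd) \<Rightarrow>\<^sub>0 'k" where
  "tensor_map f g = lin_ext (\<lambda>(a, b). tensor (f (basis_vec a)) (g (basis_vec b)))"

definition tensor_assoc :: "((('a \<times> 'b) \<times> 'c) \<Rightarrow>\<^sub>0 'k::field) \<Rightarrow> ('a \<times> 'b \<times> 'c) \<Rightarrow>\<^sub>0 'k" where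
  "tensor_assoc = lin_ext (\<lambda>((a, b), c). basis_vec (a, b, c))"

definition coassociative_on ::
  "('a \<Rightarrow>\<^sub>0 'k::field) set \<Rightarrow> (('a \<Rightarrow>\<^sub>0 'k) \<Rightarrow> ('a \<times> 'a) \<Rightarrow>\<^sub>0 'k) \<Rightarrow> bool" where
  "coassociative_on V D \<longleftrightarrow>
     (\<forall>x\<in>V. tensor_assoc (tensor_map D id (D x)) = tensor_map id D (D x))"

section \<open>The Malvenuto--Reutenauer coproduct\<close>

definition MR_basis :: "nat list set" where
  "MR_basis = (\<Union>n. permutations_of_set {1..n})"

definition MR_coproduct :: "(nat list \<Rightarrow>\<^sub>0 'k::field) \<Rightarrow> (nat list \<times> nat list) \<Rightarrow>\<^sub>0 'k" where
  "MR_coproduct = lin_ext (\<lambda>u. \<Sum>i\<le>length u.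
     tensor (basis_vec (std_word (take i u))) (basis_vec (std_word (drop i u))))"

section \<open>The comultiplication on maximal tubings\<close>

text \<open>The basis vector $\mathbb{P}_X$ for \<open>X \<in> MTub (G n)\<close> is indexed by \<open>(n, X)\<close>, an element of
  the disjoint union of the sets \<open>MTub (G n)\<close>.\<close>

definition tubing_basis :: "(nat \<Rightarrow> ugraph) \<Rightarrow> (nat \<times> nat set set) set" where
  "tubing_basis G = (SIGMA n:UNIV. MTub (G n))"

text \<open>\<open>refine_sum n G H X\<close> is $c_H^G(\mathbb{P}_X)$ for graphs \<open>H\<close>, \<open>G\<close> on \<open>{1..n}\<close>.\<close>

definition refine_sum ::
  "nat \<Rightarrow> ugraph \<Rightarrow> ugraph \<Rightarrow> nat set set \<Rightarrow> (nat \<times> nat set set) \<Rightarrow>\<^sub>0 'k::field" where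
  "refine_sum n G H X = (\<Sum>Y \<in> {Y \<in> MTub G. Psi_coarsen G H Y = X}. basis_vec (n, Y))"

definition tubing_coproduct ::
  "(nat \<Rightarrow> ugraph) \<Rightarrow> ((nat \<times> nat set set) \<Rightarrow>\<^sub>0 'k::field) \<Rightarrow>
   ((nat \<times> nat set set) \<times> (nat \<times> nat set set)) \<Rightarrow>\<^sub>0 'k" where
  "tubing_coproduct G = lin_ext (\<lambda>(n, X). \<Sum>I\<in>ideals X.
     tensor
       (refine_sum (card I) (G (card I)) (std_graph (induced (G n) I))
          (std_tubing I (restrict_tubing (G n) X I)))
       (refine_sum (n - card I) (G (n - card I)) (std_graph (contract (G n) I))
          (std_tubing ({1..n} - I) (contract_tubing X I))))"

definition tubing_embedding ::
  "(nat \<Rightarrow> ugraph) \<Rightarrow> ((nat \<times> nat set set) \<Rightarrow>\<^sub>0 'k::field) \<Rightarrow> nat list \<Rightarrow>\<^sub>0 'k" where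
  "tubing_embedding G = lin_ext (\<lambda>(n, X).
     \<Sum>w \<in> {w \<in> permutations_of_set {1..n}. Psi (G n) w = X}. basis_vec w)"

end

theory Submission
  imports Defs
begin

text \<open>
  Cutting a permutation \<open>w\<close> with \<open>\<Psi>\<^sub>G(w) = X\<close> after any prefix \<open>a\<close>, say \<open>w = ab\<close>, makes the set \<open>I\<close> of
  letters of \<open>a\<close> an ideal of \<open>X\<close>, with \<open>\<Psi>(a) = X|\<^sub>I\<close> for the graph \<open>G|\<^sub>I\<close> and \<open>\<Psi>(b) = X/I\<close> for \<open>G/I\<close>.
  Conversely, these three conditions force \<open>\<Psi>\<^sub>G(ab) = X\<close>: the smallest tube of \<open>X\<close> containing \<open>v\<close> is the
  component of \<open>v\<close> among the letters up to \<open>v\<close>, and it is determined by its restriction to \<open>I\<close> or its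
  trace outside \<open>I\<close>. So both sides of the identity are sums over the same triples \<open>(I, a, b)\<close>, because
  \<open>c\<close> composed with \<open>c\<^sub>H\<^sup>G\<close> sums over the fibre of \<open>\<Psi>\<^sub>H\<close>. As \<open>c\<close> has a left
  inverse, coassociativity is inherited from the Malvenuto--Reutenauer coproduct.
\<close>

section \<open>Components and tubes\<close>

text \<open>A maximal tubing is known only through maximality, and \<open>Psi_coarsen\<close> only
  through a definite description, so neither can be computed with directly. The device for both is
  \<open>low X v\<close>, the least tube of \<open>X\<close> containing \<open>v\<close>. A word
  lies in the fibre over \<open>X\<close> as soon as it lists \<open>u\<close> before
  \<open>v\<close> whenever \<open>low X u\<close> is strictly inside \<open>low X v\<close>. This
  criterion yields the surjectivity of \<open>Psi\<close> and, for every ideal, a word of the fibre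
  that lists the ideal first; \<open>low\<close> also makes the coarsening explicit. The converse
  half of the cutting criterion is then a comparison of two words, prefix with prefix and suffix
  with suffix. For coassociativity a left inverse of \<open>c\<close> is taken instead of bare
  injectivity because left inverses pass to tensor products factor by factor.\<close>

abbreviation cc :: "ugraph \<Rightarrow> nat set \<Rightarrow> nat \<Rightarrow> nat set" where
  "cc G S v \<equiv> component_of (induced G S) v"

lemma adj_rel_induced:
  "(i, j) \<in> adj_rel (induced G S) \<longleftrightarrow> {i, j} \<in> edges G \<and> i \<in> S \<and> j \<in> S"
  by (auto simp: adj_rel_def induced_def)

lemma simple_graph_edgeD:
  assumes "simple_graph G" "{i, j} \<in> edges G"
  shows "i \<in> verts G" "j \<in> verts G" "i \<noteq> j"
  using assms by (auto simp: simple_graph_def)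

lemma cc_subset: "cc G S u \<subseteq> verts G \<inter> S"
  by (auto simp: component_of_def induced_def)

lemma cc_refl: "u \<in> S \<Longrightarrow> u \<in> verts G \<Longrightarrow> u \<in> cc G S u"
  by (auto simp: component_of_def induced_def)

lemma cc_step:
  assumes "simple_graph G" "x \<in> cc G S u" "{x, y} \<in> edges G" "y \<in> S"
  shows "y \<in> cc G S u"
proof -
  have "x \<in> S" using assms(2) cc_subset by blast
  then have "(x, y) \<in> adj_rel (induced G S)" using assms by (simp add: adj_rel_induced)
  then show ?thesis using assms simple_graph_edgeD[OF assms(1,3)]
    by (auto simp: component_of_def induced_def intro: rtrancl_into_rtrancl)
qed

text \<open>Induction along a path inside \<open>S\<close>, with membership of the current vertex in
  the component kept as an extra hypothesis.\<close>

lemma cc_induct [consumes 2, case_names base step]: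
  assumes "simple_graph G" "v \<in> cc G S u" "P u"
    and step: "\<And>x y. x \<in> cc G S u \<Longrightarrow> P x \<Longrightarrow> {x, y} \<in> edges G \<Longrightarrow> y \<in> S \<Longrightarrow> P y"
  shows "P v"
proof -
  have "(u, v) \<in> (adj_rel (induced G S))\<^sup>*" using assms(2) by (simp add: component_of_def)
  then show ?thesis
  proof induction
    case (step x y)
    then have e: "{x, y} \<in> edges G" "x \<in> S" "y \<in> S" by (auto simp: adj_rel_induced)
    then have "x \<in> cc G S u"
      using step simple_graph_edgeD[OF assms(1) e(1)] by (auto simp: component_of_def induced_def)
    then show ?case using assms(4) step e by blast
  qed (fact assms(3))
qed

text \<open>\<open>component_of\<close> puts no condition on its root. A path of positive length
  leaves \<open>u\<close> by an edge with both ends in \<open>S\<close>, and a path of length zero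
  has \<open>u = v\<close>; so a nonempty component contains its root.\<close>

lemma cc_root:
  assumes "simple_graph G" "v \<in> cc G S u"
  shows "u \<in> cc G S u"
proof -
  have "(u, v) \<in> (adj_rel (induced G S))\<^sup>*" "v \<in> verts G \<inter> S"
    using assms(2) by (auto simp: component_of_def induced_def)
  then show ?thesis
    by (cases rule: converse_rtranclE)
      (use simple_graph_edgeD[OF assms(1)] in \<open>auto simp: adj_rel_induced intro!: cc_refl\<close>)
qed

lemma cc_sym:
  assumes "simple_graph G" "v \<in> cc G S u"
  shows "u \<in> cc G S v"
proof -
  have "sym (adj_rel (induced G S))"
    by (auto simp: sym_def adj_rel_induced insert_commute)
  then show ?thesis
    using assms cc_root[OF assms] by (auto simp: component_of_def dest: sym_rtrancl symD)
qed

lemma cc_trans: "v \<in> cc G S u \<Longrightarrow> x \<in> cc G S v \<Longrightarrow> x \<in> cc G S u"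
  by (auto simp: component_of_def)

lemma cc_eq:
  assumes "simple_graph G" "v \<in> cc G S u"
  shows "cc G S v = cc G S u"
  using cc_sym[OF assms] assms(2) by (blast intro: cc_trans)

lemma cc_mono:
  assumes "simple_graph G" "S \<subseteq> T"
  shows "cc G S u \<subseteq> cc G T u"
proof
  fix v assume v: "v \<in> cc G S u"
  show "v \<in> cc G T u"
    using assms(1) v
  proof (induction rule: cc_induct)
    case base
    then show ?case using cc_root[OF assms(1) v] cc_subset assms(2) by (blast intro: cc_refl)
  next
    case (step x y)
    then show ?case using assms by (blast intro: cc_step)
  qed
qed

text \<open>A path in \<open>S\<close> from \<open>u\<close> never leaves the component of
  \<open>u\<close>, so it survives in any \<open>T\<close> between that component and
  \<open>S\<close>. Used to compare components taken in different vertex sets.\<close>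

lemma cc_shrink:
  assumes "simple_graph G" "cc G S u \<subseteq> T" "T \<subseteq> S"
  shows "cc G T u = cc G S u"
proof
  show "cc G T u \<subseteq> cc G S u" using assms by (intro cc_mono)
  show "cc G S u \<subseteq> cc G T u"
  proof
    fix v assume v: "v \<in> cc G S u"
    show "v \<in> cc G T u"
      using assms(1) v
    proof (induction rule: cc_induct)
      case base
      then show ?case using cc_root[OF assms(1) v] cc_subset assms(2) by (blast intro: cc_refl)
    next
      case (step x y)
      then have "y \<in> T" using cc_step[OF assms(1) step(1)] assms(2) by blast
      then show ?case using step assms by (blast intro: cc_step)
    qed
  qed
qed

lemma tube_ccD:
  assumes "tube G J" "u \<in> J"
  shows "cc G J u = J"
proof -
  have "verts (induced G J) = J" using assms by (auto simp: tube_def induced_def)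
  then show ?thesis using assms by (auto simp: tube_def graph_connected_def component_of_def)
qed

lemma tubeI:
  assumes G: "simple_graph G" and u: "u \<in> J" "u \<in> verts G" and J: "J \<subseteq> cc G J u"
  shows "tube G J"
proof -
  have V: "verts (induced G J) = J" using J cc_subset by (fastforce simp: induced_def)
  have "(x, y) \<in> (adj_rel (induced G J))\<^sup>*" if "x \<in> J" "y \<in> J" for x y
  proof -
    have "u \<in> cc G J x" using that J cc_sym[OF G] by blast
    then have "y \<in> cc G J x" using that J cc_trans by blast
    then show ?thesis by (simp add: component_of_def)
  qed
  then show ?thesis using u J cc_subset[of G J u]
    by (auto simp: tube_def graph_connected_def V)
qed

lemma tube_cc:
  assumes "simple_graph G" "u \<in> S" "u \<in> verts G"
  shows "tube G (cc G S u)"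
proof (rule tubeI[OF assms(1), of u])
  show "u \<in> cc G S u" using assms by (intro cc_refl)
  have "cc G (cc G S u) u = cc G S u" using cc_subset by (intro cc_shrink assms) auto
  then show "cc G S u \<subseteq> cc G (cc G S u) u" by simp
qed (fact assms)

lemma tube_subset_cc:
  assumes "simple_graph G" "tube G J" "J \<subseteq> S" "u \<in> J"
  shows "J \<subseteq> cc G S u"
  using cc_mono[OF assms(1,3), of u] tube_ccD[OF assms(2,4)] by simp

text \<open>Walking from \<open>u\<close> inside \<open>J\<close>, no step can leave
  \<open>A\<close>. In the main applications \<open>A\<close> is a tube of a tubing, and an edge
  leaving it would force a nesting that contradicts the order of the letters.\<close>

lemma tube_subset_closed:
  assumes G: "simple_graph G" and J: "tube G J" and u: "u \<in> J" "u \<in> A"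
    and A: "\<And>x y. x \<in> J \<Longrightarrow> x \<in> A \<Longrightarrow> y \<in> J \<Longrightarrow> {x, y} \<in> edges G \<Longrightarrow> y \<in> A"
  shows "J \<subseteq> A"
proof
  fix v assume "v \<in> J"
  then have "v \<in> cc G J u" using tube_ccD[OF J] u by simp
  with G show "v \<in> A"
  proof (induction rule: cc_induct)
    case (step x y)
    then show ?case using A tube_ccD[OF J u(1)] by blast
  qed (fact u)
qed

text \<open>Turns compatibility into nesting: tubes of a tubing that meet or touch have a tube as
  their union, so one contains the other.\<close>

lemma tube_Un:
  assumes G: "simple_graph G" and I: "tube G I" "x \<in> I" and J: "tube G J" "y \<in> J"
    and xy: "x = y \<or> {x, y} \<in> edges G"
  shows "tube G (I \<union> J)"
proof (rule tubeI[OF G, of x])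
  show "x \<in> I \<union> J" "x \<in> verts G" using I by (auto simp: tube_def)
  have 1: "I \<subseteq> cc G (I \<union> J) x" using I by (intro tube_subset_cc G) auto
  have "y \<in> cc G (I \<union> J) x"
    using xy 1 I J cc_step[OF G, of x "I \<union> J" x y] by blast
  then have "cc G (I \<union> J) y = cc G (I \<union> J) x" by (rule cc_eq[OF G])
  moreover have "J \<subseteq> cc G (I \<union> J) y" using J by (intro tube_subset_cc G) auto
  ultimately show "I \<union> J \<subseteq> cc G (I \<union> J) x" using 1 by blast
qed

section \<open>Prefixes of words and maximal tubings\<close>

text \<open>Prefixes are indexed by their last letter instead of a position, so that
  \<open>Psi\<close> becomes an image over the vertex set and words can be handled by induction. For
  \<open>v\<close> outside \<open>w\<close> the value is all letters of \<open>w\<close> together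
  with \<open>v\<close>.\<close>

definition prefix_upto :: "nat list \<Rightarrow> nat \<Rightarrow> nat set" where
  "prefix_upto w v = insert v (set (takeWhile (\<lambda>x. x \<noteq> v) w))"

lemma prefix_upto_self: "v \<in> prefix_upto w v"
  by (simp add: prefix_upto_def)

lemma prefix_upto_subset: "v \<in> set w \<Longrightarrow> prefix_upto w v \<subseteq> set w"
  by (auto simp: prefix_upto_def dest: set_takeWhileD)

lemma prefix_upto_append:
  "prefix_upto (a @ b) v = (if v \<in> set a then prefix_upto a v else set a \<union> prefix_upto b v)"
  by (auto simp: prefix_upto_def takeWhile_append)

lemma prefix_upto_Nil: "prefix_upto [] v = {v}"
  by (simp add: prefix_upto_def)

lemma prefix_upto_Cons:
  "prefix_upto (x # w) v = (if x = v then {v} else insert x (prefix_upto w v))"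
  by (cases "x = v") (auto simp: prefix_upto_def)

lemma prefix_upto_mono: "u \<in> prefix_upto w v \<Longrightarrow> prefix_upto w u \<subseteq> prefix_upto w v"
  by (induction w) (auto simp: prefix_upto_Cons prefix_upto_Nil split: if_splits)

lemma prefix_upto_total: "u \<in> set w \<Longrightarrow> v \<in> set w \<Longrightarrow> u \<in> prefix_upto w v \<or> v \<in> prefix_upto w u"
  by (induction w) (auto simp: prefix_upto_Cons prefix_upto_self)

lemma prefix_upto_antisym:
  "u \<in> set w \<Longrightarrow> v \<in> set w \<Longrightarrow> u \<in> prefix_upto w v \<Longrightarrow> v \<in> prefix_upto w u \<Longrightarrow> u = v"
  by (induction w) (auto simp: prefix_upto_Cons prefix_upto_self split: if_splits)

lemma prefix_upto_nth:
  assumes "distinct w" "j < length w"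
  shows "set (take (Suc j) w) = prefix_upto w (w ! j)"
proof -
  have "takeWhile (\<lambda>x. x \<noteq> w ! j) w = take j w"
    using assms by (intro takeWhile_eq_take_P_nth) (auto simp: nth_eq_iff_index_eq)
  then show ?thesis using assms by (simp add: prefix_upto_def take_Suc_conv_app_nth)
qed

lemma prefix_upto_map:
  "inj_on f (insert v (set w)) \<Longrightarrow> prefix_upto (map f w) (f v) = f ` prefix_upto w v"
  by (induction w) (auto simp: prefix_upto_Cons prefix_upto_Nil inj_on_def)

lemma prefix_upto_last:
  assumes "finite A" "A \<noteq> {}" "A \<subseteq> set w"
  shows "\<exists>v\<in>A. A \<subseteq> prefix_upto w v"
  using assms
proof (induction A rule: finite_ne_induct)
  case (insert x F)
  then obtain v where v: "v \<in> F" "F \<subseteq> prefix_upto w v" by auto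
  then show ?case
    using insert prefix_upto_total[of x w v] prefix_upto_mono[of v w x] prefix_upto_self[of x w]
    by (cases "x \<in> prefix_upto w v") auto
qed (auto simp: prefix_upto_self)

lemma prefix_upto_sorted:
  assumes "sorted (map f w)" "v \<in> set w" "u \<in> set w" "f u < f v"
  shows "u \<in> prefix_upto w v"
  using assms by (induction w) (auto simp: prefix_upto_Cons prefix_upto_self)

lemma Psi_eq: "distinct w \<Longrightarrow> Psi G w = (\<lambda>v. cc G (prefix_upto w v) v) ` set w"
  by (fastforce simp: Psi_def prefix_upto_nth image_iff in_set_conv_nth)

text \<open>The intersection is itself a tube of \<open>X\<close> when \<open>X\<close> is a maximal
  tubing and \<open>v\<close> a vertex (\<open>low_in\<close>). If no tube contains
  \<open>v\<close>, the value is \<open>UNIV\<close>.\<close>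

definition low :: "nat set set \<Rightarrow> nat \<Rightarrow> nat set" where
  "low X v = \<Inter>{J \<in> X. v \<in> J}"

lemma low_lower: "J \<in> X \<Longrightarrow> v \<in> J \<Longrightarrow> low X v \<subseteq> J"
  by (auto simp: low_def)

lemma low_self: "v \<in> low X v"
  by (auto simp: low_def)

section \<open>The tubing of a word is maximal\<close>

locale graph_word =
  fixes G :: ugraph and w :: "nat list"
  assumes G: "simple_graph G" and w: "distinct w" "set w = verts G"
begin

lemma cc_prefix_upto_self: "v \<in> verts G \<Longrightarrow> v \<in> cc G (prefix_upto w v) v"
  by (simp add: cc_refl prefix_upto_self)

text \<open>If \<open>v\<close> lies in the component at \<open>u\<close>, then \<open>v\<close>
  does not come after \<open>u\<close>, so the component at \<open>v\<close> is contained in the one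
  at \<open>u\<close>. Hence the component at each letter depends on the tubing alone, not on the
  word chosen in its fibre.\<close>

lemma low_Psi:
  assumes v: "v \<in> verts G"
  shows "low (Psi G w) v = cc G (prefix_upto w v) v"
proof
  show "low (Psi G w) v \<subseteq> cc G (prefix_upto w v) v"
    using v w by (intro low_lower) (auto intro!: cc_prefix_upto_self simp: Psi_eq)
  have "cc G (prefix_upto w v) v \<subseteq> J" if "J \<in> Psi G w" "v \<in> J" for J
  proof -
    obtain u where u: "u \<in> verts G" "J = cc G (prefix_upto w u) u" using \<open>J \<in> Psi G w\<close> w
      by (auto simp: Psi_eq)
    then have "v \<in> prefix_upto w u" using that cc_subset by blast
    then have "cc G (prefix_upto w v) v \<subseteq> cc G (prefix_upto w u) v"
      by (intro cc_mono G prefix_upto_mono)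
    then show ?thesis using cc_eq[OF G] u that by blast
  qed
  then show "cc G (prefix_upto w v) v \<subseteq> low (Psi G w) v" by (auto simp: low_def)
qed

lemma tube_cc_prefix_upto: "v \<in> verts G \<Longrightarrow> tube G (cc G (prefix_upto w v) v)"
  by (simp add: tube_cc G prefix_upto_self)

text \<open>Let \<open>u\<close> come no later than \<open>v\<close>. If the union of their
  components is a tube, it lies in the prefix up to \<open>v\<close> and contains \<open>v\<close>,
  so it is contained in the component at \<open>v\<close>.\<close>

lemma tubing_Psi: "tubing G (Psi G w)"
proof -
  have *: "cc G (prefix_upto w u) u \<subseteq> cc G (prefix_upto w v) v"
    if t: "tube G (cc G (prefix_upto w u) u \<union> cc G (prefix_upto w v) v)" and "u \<in> prefix_upto w v"
      and "v \<in> verts G" for u v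
  proof -
    have "cc G (prefix_upto w u) u \<union> cc G (prefix_upto w v) v \<subseteq> prefix_upto w v"
      using prefix_upto_mono[OF that(2)] cc_subset by blast
    then have "cc G (prefix_upto w u) u \<union> cc G (prefix_upto w v) v \<subseteq> cc G (prefix_upto w v) v"
      using that by (intro tube_subset_cc[OF G t]) (auto intro: cc_prefix_upto_self)
    then show ?thesis by blast
  qed
  have "compatible G (cc G (prefix_upto w u) u) (cc G (prefix_upto w v) v)"
    if "u \<in> verts G" "v \<in> verts G" for u v
    using *[of u v] *[of v u] that prefix_upto_total[of u w v] w
    by (auto simp: compatible_def Un_commute)
  then show ?thesis
    by (auto simp: tubing_def Psi_eq w tube_cc_prefix_upto)
qed

text \<open>A tube \<open>J\<close> of a larger tubing is the component at its last letter
  \<open>v\<close>. An edge from \<open>J\<close> to a vertex \<open>y\<close> of that component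
  outside \<open>J\<close> would make the component at \<open>y\<close> touch \<open>J\<close>,
  hence contain it; then \<open>v\<close> would come no later than \<open>y\<close>, forcing
  \<open>y = v\<close>, which lies in \<open>J\<close>.\<close>

lemma Psi_MTub: "Psi G w \<in> MTub G"
proof -
  have "J \<in> Psi G w" if Y: "tubing G Y" "Psi G w \<subseteq> Y" and J: "J \<in> Y" for Y J
  proof -
    have tJ: "tube G J" using Y J by (auto simp: tubing_def)
    then have "finite J" "J \<noteq> {}" "J \<subseteq> verts G"
      using G finite_subset by (auto simp: tube_def simple_graph_def)
    then obtain v where v: "v \<in> J" "J \<subseteq> prefix_upto w v" using prefix_upto_last[of J w] w by auto
    then have vG: "v \<in> verts G" using \<open>J \<subseteq> verts G\<close> by auto
    have sub: "J \<subseteq> cc G (prefix_upto w v) v" using v by (intro tube_subset_cc G tJ)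
    moreover have "cc G (prefix_upto w v) v \<subseteq> J"
    proof (rule tube_subset_closed[OF G tube_cc_prefix_upto])
      fix x y assume xy: "x \<in> J" "y \<in> cc G (prefix_upto w v) v" "{x, y} \<in> edges G"
      show "y \<in> J"
      proof (rule ccontr)
        assume "y \<notin> J"
        have yG: "y \<in> verts G" "y \<in> prefix_upto w v" using xy cc_subset by blast+
        have "tube G (J \<union> cc G (prefix_upto w y) y)"
          using xy yG
            by (intro tube_Un[OF G tJ xy(1), of _ y] tube_cc_prefix_upto cc_prefix_upto_self) auto
        moreover have "cc G (prefix_upto w y) y \<in> Y" using Y yG w by (auto simp: Psi_eq)
        ultimately have "J \<subseteq> cc G (prefix_upto w y) y \<or> cc G (prefix_upto w y) y \<subseteq> J"
          using Y(1) J unfolding tubing_def compatible_def by blast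
        then have "v \<in> prefix_upto w y"
          using \<open>y \<notin> J\<close> v(1) cc_prefix_upto_self[OF yG(1)] cc_subset by blast
        then show False using prefix_upto_antisym[of v w y] yG vG w v \<open>y \<notin> J\<close> by auto
      qed
    qed (use v vG in \<open>auto intro: cc_prefix_upto_self\<close>)
    ultimately show ?thesis using vG w by (auto simp: Psi_eq)
  qed
  then show ?thesis using tubing_Psi unfolding MTub_def by blast
qed

end

section \<open>Least tubes, the fibre criterion and surjectivity\<close>

lemma MTub_tube: "X \<in> MTub G \<Longrightarrow> J \<in> X \<Longrightarrow> tube G J"
  by (auto simp: MTub_def tubing_def)

lemma MTub_nested:
  "X \<in> MTub G \<Longrightarrow> I \<in> X \<Longrightarrow> J \<in> X \<Longrightarrow> tube G (I \<union> J) \<Longrightarrow> I \<subseteq> J \<or> J \<subseteq> I"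
  by (auto simp: MTub_def tubing_def compatible_def)

lemma tubing_Un:
  assumes "tubing G X" "tubing G Y"
    and "\<And>I J. I \<in> X \<Longrightarrow> J \<in> Y \<Longrightarrow> compatible G I J \<and> compatible G J I"
  shows "tubing G (X \<union> Y)"
  using assms by (simp add: tubing_def ball_Un)

lemma MTub_superset:
  assumes X: "X \<in> MTub G" and Y: "tubing G (X \<union> Y)"
  shows "Y \<subseteq> X"
  using assms by (auto simp: MTub_def)

lemma MTub_subset: "X \<in> MTub G \<Longrightarrow> X \<subseteq> Pow (verts G)"
  by (meson MTub_tube PowI subsetI tube_def)

lemma finite_MTub: "simple_graph G \<Longrightarrow> finite (MTub G)"
  by (rule finite_subset[of _ "Pow (Pow (verts G))"])
    (auto dest: MTub_subset simp: simple_graph_def)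

text \<open>A whole component of the graph absorbs every tube with which its union is a tube, so it
  is compatible with all tubes and maximality puts it into \<open>X\<close>. This provides at least
  one tube around each vertex.\<close>

lemma MTub_component:
  assumes G: "simple_graph G" and X: "X \<in> MTub G" and v: "v \<in> verts G"
  shows "cc G (verts G) v \<in> X"
proof -
  let ?C = "cc G (verts G) v"
  have C: "tube G ?C" using v by (intro tube_cc G)
  have *: "compatible G ?C J" "compatible G J ?C" if "tube G J" for J
  proof -
    have "J \<subseteq> ?C" if t: "tube G (?C \<union> J)"
    proof -
      have "?C \<union> J \<subseteq> cc G (verts G) v"
        using t v by (intro tube_subset_cc[OF G t]) (auto simp: tube_def intro: cc_refl)
      then show ?thesis by blast
    qed
    then show "compatible G ?C J" "compatible G J ?C" by (auto simp: compatible_def Un_commute)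
  qed
  have "tubing G {?C}" using C by (simp add: tubing_def compatible_def)
  then have "tubing G (X \<union> {?C})"
    using X * MTub_tube[OF X] by (intro tubing_Un) (auto simp: MTub_def)
  then show ?thesis using MTub_superset[OF X] by blast
qed

text \<open>Tubes of \<open>X\<close> through \<open>v\<close> meet, so they are nested; a finite
  nonempty chain contains its intersection.\<close>

lemma low_in:
  assumes G: "simple_graph G" and X: "X \<in> MTub G" and v: "v \<in> verts G"
  shows "low X v \<in> X"
proof -
  let ?A = "{J \<in> X. v \<in> J}"
  have "finite X" using MTub_subset[OF X] G by (meson finite_Pow_iff finite_subset simple_graph_def)
  then have "finite ?A" by simp
  moreover have "?A \<noteq> {}" using MTub_component[OF assms] v cc_refl by blast
  moreover have nested: "I \<subseteq> J \<or> J \<subseteq> I" if "I \<in> ?A" "J \<in> ?A" for I J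
    using that by (intro MTub_nested[OF X] tube_Un[OF G, of I v J v] MTub_tube[OF X]) auto
  have "I \<inter> J \<in> ?A" if "I \<in> ?A" "J \<in> ?A" for I J
    using nested[OF that]
  proof
    show ?thesis if "I \<subseteq> J" using that \<open>I \<in> ?A\<close> by (simp only: Int_absorb2)
    show ?thesis if "J \<subseteq> I" using that \<open>J \<in> ?A\<close> by (simp only: Int_absorb1)
  qed
  ultimately have "\<Inter>?A \<in> ?A" by (intro finite_Inf_in)
  then show ?thesis by (simp add: low_def)
qed

text \<open>All tubes of \<open>X\<close> are compatible with all components of the word, and two
  maximal tubings with this property coincide. The case to watch is a tube \<open>J\<close> with a
  letter \<open>u\<close> outside the prefix up to \<open>v\<close>: an edge leaving
  \<open>J\<close> to a vertex \<open>y\<close> of the component at \<open>v\<close> would give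
  \<open>J\<close> strictly inside \<open>low X y\<close>, so \<open>u\<close> would precede
  \<open>y\<close> and lie in the prefix after all.\<close>

lemma (in graph_word) Psi_eqI:
  assumes X: "X \<in> MTub G"
    and up: "\<And>u v. u \<in> verts G \<Longrightarrow> v \<in> verts G \<Longrightarrow> low X u \<subset> low X v \<Longrightarrow> u \<in> prefix_upto w v"
  shows "Psi G w = X"
proof -
  have *: "compatible G J (cc G (prefix_upto w v) v) \<and> compatible G (cc G (prefix_upto w v) v) J"
    if v: "v \<in> verts G" and J: "J \<in> X" for v J
  proof (cases "tube G (J \<union> cc G (prefix_upto w v) v)")
    case t: True
    show ?thesis
    proof (cases "J \<subseteq> prefix_upto w v")
      case True
      then have "J \<union> cc G (prefix_upto w v) v \<subseteq> cc G (prefix_upto w v) v"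
        using cc_subset v by (intro tube_subset_cc[OF G t]) (auto intro: cc_prefix_upto_self)
      then show ?thesis by (auto simp: compatible_def)
    next
      case False
      then obtain u where u: "u \<in> J" "u \<notin> prefix_upto w v" by blast
      have tJ: "tube G J" using MTub_tube[OF X J] .
      then have uG: "u \<in> verts G" using u by (auto simp: tube_def)
      have "J \<union> cc G (prefix_upto w v) v \<subseteq> J"
      proof (rule tube_subset_closed[OF G t, of u])
        fix x y assume xy: "x \<in> J" "y \<in> J \<union> cc G (prefix_upto w v) v" "{x, y} \<in> edges G"
        show "y \<in> J"
        proof (rule ccontr)
          assume "y \<notin> J"
          then have y: "y \<in> prefix_upto w v" "y \<in> verts G" using xy cc_subset by blast+
          have "tube G (J \<union> low X y)"
            using xy y by (intro tube_Un[OF G tJ xy(1), of _ y] MTub_tube[OF X] low_in[OF G X] low_self) auto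
          then have "J \<subseteq> low X y \<or> low X y \<subseteq> J"
            using MTub_nested[OF X J low_in[OF G X y(2)]] by blast
          then have "J \<subset> low X y" using low_self[of y X] \<open>y \<notin> J\<close> by blast
          then have "low X u \<subset> low X y" using low_lower[OF J u(1)] by blast
          then have "u \<in> prefix_upto w y" using up uG y by blast
          then show False using prefix_upto_mono y(1) u(2) by blast
        qed
      qed (use u in auto)
      then show ?thesis by (auto simp: compatible_def)
    qed
  qed (auto simp: compatible_def Un_commute)
  have "tubing G (X \<union> Psi G w)"
    using X tubing_Psi * by (intro tubing_Un) (auto simp: MTub_def Psi_eq w)
  then show ?thesis using MTub_superset[OF X] MTub_superset[OF Psi_MTub]
    by (simp add: Un_commute subset_antisym)
qed

text \<open>Listing the vertices by increasing \<open>f\<close> meets the criterion of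
  \<open>Psi_eqI\<close>; ties in \<open>f\<close> occur only between vertices on whose order the
  criterion is silent.\<close>

lemma Psi_eq_ex:
  assumes G: "simple_graph G" and X: "X \<in> MTub G"
    and f: "\<And>u v. u \<in> verts G \<Longrightarrow> v \<in> verts G \<Longrightarrow> low X u \<subset> low X v \<Longrightarrow> f u < (f v :: nat)"
  obtains w where "distinct w" "set w = verts G" "sorted (map f w)" "Psi G w = X"
proof -
  have fin: "finite (verts G)" using G by (simp add: simple_graph_def)
  define w' where "w' = sort_key f (sorted_list_of_set (verts G))"
  have w': "distinct w'" "set w' = verts G" "sorted (map f w')" using fin by (auto simp: w'_def)
  interpret graph_word G w' by unfold_locales (fact G w')+
  have "Psi G w' = X"
    using prefix_upto_sorted[OF w'(3)] f by (intro Psi_eqI[OF X]) (simp add: w'(2))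
  then show ?thesis using that w' by blast
qed

lemma card_low_mono:
  assumes G: "simple_graph G" and X: "X \<in> MTub G" and "v \<in> verts G" "low X u \<subset> low X v"
  shows "card (low X u) < card (low X v)"
proof -
  have "low X v \<subseteq> verts G" using low_in[OF G X] MTub_subset[OF X] assms by blast
  then have "finite (low X v)" using G finite_subset simple_graph_def by metis
  then show ?thesis using assms by (intro psubset_card_mono)
qed

text \<open>The cardinality of \<open>low X v\<close> serves as the sorting key: it grows strictly
  along strict inclusions.\<close>

lemma Psi_surj:
  assumes G: "simple_graph G"
  shows "Psi G ` permutations_of_set (verts G) = MTub G"
proof -
  have "X \<in> Psi G ` permutations_of_set (verts G)" if X: "X \<in> MTub G" for X
    using Psi_eq_ex[OF G X, of "\<lambda>v. card (low X v)"] card_low_mono[OF G X]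
    by (metis image_eqI permutations_of_setI)
  moreover have "Psi G w \<in> MTub G" if "w \<in> permutations_of_set (verts G)" for w
    using graph_word.Psi_MTub[of G w] that G by (auto simp: graph_word_def permutations_of_set_def)
  ultimately show ?thesis by blast
qed

text \<open>A component of \<open>H\<close> in a prefix is contained in the corresponding component of \<open>G\<close>, so the
  fibres of \<open>Psi G\<close> refine those of \<open>Psi H\<close>.\<close>

lemma Psi_subgraph:
  assumes G: "simple_graph G" and H: "simple_graph H" and V: "verts H = verts G"
    and E: "edges H \<subseteq> edges G" and w: "distinct w" "set w = verts G"
  shows "Psi H w = (\<lambda>v. cc H (low (Psi G w) v) v) ` verts G"
proof -
  interpret G: graph_word G w by unfold_locales (fact G w)+
  have "cc H (low (Psi G w) v) v = cc H (prefix_upto w v) v" if v: "v \<in> verts G" for v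
  proof (rule cc_shrink[OF H])
    show "low (Psi G w) v \<subseteq> prefix_upto w v" using G.low_Psi[OF v] cc_subset by auto
    show "cc H (prefix_upto w v) v \<subseteq> low (Psi G w) v"
    proof
      fix x assume "x \<in> cc H (prefix_upto w v) v"
      with H show "x \<in> low (Psi G w) v"
      proof (induction rule: cc_induct)
        case (step x y)
        then show ?case using G.low_Psi[OF v] E cc_step[OF G] by blast
      qed (simp add: low_self)
    qed
  qed
  then show ?thesis using w by (simp add: Psi_eq)
qed

text \<open>The definite description is resolved by exhibiting the map: \<open>X\<close> goes to the
  \<open>H\<close>-components of \<open>v\<close> inside \<open>low X v\<close>, as read off from
  \<open>Psi_subgraph\<close>. It is unique because \<open>Psi G\<close> reaches all of
  \<open>MTub G\<close> and extensionality fixes the remaining values.\<close>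

lemma Psi_coarsen_Psi:
  assumes G: "simple_graph G" and H: "simple_graph H" and V: "verts H = verts G"
    and E: "edges H \<subseteq> edges G" and w: "w \<in> permutations_of_set (verts G)"
  shows "Psi_coarsen G H (Psi G w) = Psi H w"
proof -
  let ?P = "\<lambda>f. f \<in> extensional (MTub G) \<and> f ` MTub G = MTub H \<and>
     (\<forall>w\<in>permutations_of_set (verts G). f (Psi G w) = Psi H w)"
  let ?f = "\<lambda>X\<in>MTub G. (\<lambda>v. cc H (low X v) v) ` verts G"
  have *: "?f (Psi G w) = Psi H w" if w: "w \<in> permutations_of_set (verts G)" for w
  proof -
    have "Psi G w \<in> MTub G" using Psi_surj[OF G] w by blast
    then show ?thesis using Psi_subgraph[OF G H V E] w by (simp add: permutations_of_set_def)
  qed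
  have "?f ` MTub G = (\<lambda>w. ?f (Psi G w)) ` permutations_of_set (verts G)"
    unfolding Psi_surj[OF G, symmetric] image_image ..
  also have "\<dots> = Psi H ` permutations_of_set (verts G)" using * by (rule image_cong[OF refl])
  also have "\<dots> = MTub H" using Psi_surj[OF H] V by simp
  finally have "?P ?f" using * by auto
  moreover have "g = ?f" if g: "?P g" for g
  proof (rule extensionalityI[of _ "MTub G"])
    fix X assume "X \<in> MTub G"
    then obtain w where w: "w \<in> permutations_of_set (verts G)" and X: "X = Psi G w"
      using Psi_surj[OF G] by blast
    have "g (Psi G w) = Psi H w" using g w by (elim conjE bspec)
    then show "g X = ?f X" using *[OF w] X by simp
  qed (use g in \<open>elim conjE; simp\<close>, simp)
  ultimately have "?P (Psi_coarsen G H)" unfolding Psi_coarsen_def by (rule theI)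
  then show ?thesis using w by (elim conjE bspec)
qed

section \<open>Restriction and contraction\<close>

lemma induced_induced: "induced (induced G S) T = induced G (S \<inter> T)"
  by (auto simp: induced_def)

lemma verts_induced: "verts (induced G S) = verts G \<inter> S"
  by (simp add: induced_def)

lemma verts_contract: "verts (contract G I) = verts G - I"
  by (simp add: contract_def)

lemma simple_graph_induced: "simple_graph G \<Longrightarrow> simple_graph (induced G S)"
  by (auto simp: simple_graph_def induced_def)

lemma simple_graph_contract: "simple_graph G \<Longrightarrow> simple_graph (contract G S)"
  by (auto simp: simple_graph_def contract_def)

text \<open>The tube in the definition of the contraction is replaced by reachability inside
  \<open>I\<close>: a tube through \<open>k\<close> and \<open>l\<close> exists exactly when both
  lie in one component, which is then such a tube.\<close>

lemma contract_edge_iff: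
  assumes G: "simple_graph G"
  shows "{x, y} \<in> edges (contract G I) \<longleftrightarrow> x \<in> verts G - I \<and> y \<in> verts G - I \<and> x \<noteq> y \<and>
    ({x, y} \<in> edges G \<or> (\<exists>k l. l \<in> cc G I k \<and> {x, k} \<in> edges G \<and> {y, l} \<in> edges G))"
proof -
  have *: "(\<exists>J. tube (induced G I) J \<and> k \<in> J \<and> l \<in> J) \<longleftrightarrow> l \<in> cc G I k" for k l
  proof
    assume "\<exists>J. tube (induced G I) J \<and> k \<in> J \<and> l \<in> J"
    then obtain J where J: "tube (induced G I) J" "k \<in> J" "l \<in> J" by blast
    then have "l \<in> cc G (I \<inter> J) k" using tube_ccD by (metis induced_induced)
    then show "l \<in> cc G I k" using cc_mono[OF G, of "I \<inter> J" I k] by blast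
  next
    assume l: "l \<in> cc G I k"
    then have k: "k \<in> cc G I k" by (rule cc_root[OF G])
    then have "k \<in> I" "k \<in> verts (induced G I)" using cc_subset[of G I k]
      by (auto simp: verts_induced)
    then have "tube (induced G I) (cc (induced G I) I k)"
      by (intro tube_cc simple_graph_induced G)
    then show "\<exists>J. tube (induced G I) J \<and> k \<in> J \<and> l \<in> J"
      using k l by (auto simp: induced_induced)
  qed
  \<comment> \<open>\<open>B i j\<close> says that \<open>i\<close> and \<open>j\<close> are joined
    through \<open>I\<close>. Edges are unordered sets while the condition is stated for ordered
    pairs, so the symmetry of \<open>B\<close> is needed at the end.\<close>
  define B where "B i j \<longleftrightarrow> (\<exists>k l. l \<in> cc G I k \<and> {i, k} \<in> edges G \<and> {j, l} \<in> edges G)" for i j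
  have **: "(\<exists>J k l. tube (induced G I) J \<and> k \<in> J \<and> l \<in> J \<and> {i, k} \<in> edges G \<and> {j, l} \<in> edges G)
    \<longleftrightarrow> B i j" for i j
    unfolding B_def *[symmetric] by blast
  let ?R = "\<lambda>i j. i \<in> verts G - I \<and> j \<in> verts G - I \<and> i \<noteq> j \<and> ({i, j} \<in> edges G \<or> B i j)"
  have "edges (contract G I) = {{i, j} |i j. ?R i j}"
    by (simp only: contract_def ** ugraph.simps)
  then have "{x, y} \<in> edges (contract G I) \<longleftrightarrow> ?R x y \<or> ?R y x"
    by (auto simp only: mem_Collect_eq doubleton_eq_iff)
  moreover have "B x y" if "B y x" using that cc_sym[OF G] unfolding B_def by blast
  then have "?R x y" if "?R y x" using that by (simp add: insert_commute) blast
  ultimately show ?thesis unfolding B_def by blast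
qed

text \<open>An edge of the contraction unfolds to an edge or to a path through \<open>I\<close>,
  which stays in \<open>S\<close> because \<open>I\<close> does. Conversely, each excursion of a
  path into \<open>I\<close> is short-cut by one edge of the contraction.\<close>

lemma cc_contract:
  assumes G: "simple_graph G" and I: "I \<subseteq> S" and v: "v \<notin> I"
  shows "cc (contract G I) (S - I) v = cc G S v - I" (is "?L = ?R")
proof
  note C = simple_graph_contract[OF G]
  show "?L \<subseteq> ?R"
  proof
    fix x assume x: "x \<in> ?L"
    from C x show "x \<in> ?R"
    proof (induction rule: cc_induct)
      case base
      have "v \<in> ?L" using cc_root[OF C x] .
      then have "v \<in> S" "v \<in> verts G" using cc_subset by (fastforce simp: verts_contract)+
      then show ?case using v by (simp add: cc_refl)
    next
      case (step x y)
      have y: "y \<in> S" "y \<notin> I" using step(3) by auto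
      consider "{x, y} \<in> edges G" | k l where "l \<in> cc G I k" "{x, k} \<in> edges G" "{y, l} \<in> edges G"
        using step(2) contract_edge_iff[OF G] by metis
      then show ?case
      proof cases
        case 1
        then show ?thesis using step y cc_step[OF G, of x S v y] by blast
      next
        case (2 k l)
        have "k \<in> I" using cc_root[OF G 2(1)] cc_subset by blast
        then have "k \<in> cc G S v" using 2 step(4) I cc_step[OF G, of x S v k] by blast
        then have "l \<in> cc G S v" using 2(1) cc_mono[OF G I, of k] cc_trans by blast
        then show ?thesis using 2(3) y cc_step[OF G, of l S v y] by (simp add: insert_commute)
      qed
    qed
  qed
  show "?R \<subseteq> ?L"
  proof
    fix x assume x: "x \<in> ?R"
    then have xS: "x \<in> cc G S v" by simp
    \<comment> \<open>Strengthened invariant: while the path is inside \<open>I\<close>, the vertex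
      \<open>j\<close> from which \<open>I\<close> can be entered is remembered, together with an
      entry point \<open>k\<close> connected within \<open>I\<close> to the current vertex.\<close>
    from G xS have "(x \<notin> I \<longrightarrow> x \<in> ?L) \<and> (x \<in> I \<longrightarrow> (\<exists>j\<in>?L. \<exists>k. {j, k} \<in> edges G \<and> x \<in> cc G I k))"
    proof (induction rule: cc_induct)
      case base
      have "v \<in> S" "v \<in> verts G" using cc_root[OF G xS] cc_subset by blast+
      then show ?case using v by (auto intro!: cc_refl simp: verts_contract)
    next
      case (step x y)
      note e = simple_graph_edgeD[OF G step(2)]
      show ?case
      proof (cases "x \<in> I")
        case False
        then have xL: "x \<in> ?L" using step by blast
        show ?thesis
        proof (cases "y \<in> I")
          case True
          then show ?thesis using xL step(2) cc_refl e by blast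
        next
          case False
          then have "{x, y} \<in> edges (contract G I)"
            using e step(2) \<open>x \<notin> I\<close> by (simp add: contract_edge_iff[OF G])
          then show ?thesis using cc_step[OF C xL] False step(3) by blast
        qed
      next
        case True
        then obtain j k where j: "j \<in> ?L" "{j, k} \<in> edges G" "x \<in> cc G I k" using step by blast
        show ?thesis
        proof (cases "y \<in> I")
          case True
          then show ?thesis using j step(2) cc_step[OF G j(3)] by blast
        next
          case False
          show ?thesis
          \<comment> \<open>The excursion may return to the vertex it started from; the contraction
            has no loop there, and no edge is required.\<close>
          proof (cases "j = y")
            case True
            then show ?thesis using j False by simp
          next
            case ne: False
            have "j \<in> verts G - I" using j(1) cc_subset by (fastforce simp: verts_contract)
            then have "{j, y} \<in> edges (contract G I)"
              using e False ne j(2,3) step(2)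
              by (simp add: contract_edge_iff[OF G]) (metis insert_commute)
            then show ?thesis using cc_step[OF C j(1)] False step(3) by blast
          qed
        qed
      qed
    qed
    then show "x \<in> ?L" using x by blast
  qed
qed

section \<open>Cutting a word into a prefix and a suffix\<close>

lemma Psi_induced:
  assumes "distinct a"
  shows "Psi (induced G (set a)) a = (\<lambda>v. cc G (prefix_upto a v) v) ` set a"
proof -
  have "set a \<inter> prefix_upto a v = prefix_upto a v" if "v \<in> set a" for v
    using prefix_upto_subset[OF that] by blast
  then show ?thesis by (simp add: Psi_eq assms induced_induced)
qed

text \<open>This is \<open>cc_contract\<close> for the prefix of the whole word: removing the
  letters of \<open>a\<close> from it leaves the prefix of \<open>b\<close>.\<close>

lemma cc_contract_prefix:
  assumes "simple_graph G" "distinct (a @ b)" "v \<in> set b"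
  shows "cc (contract G (set a)) (prefix_upto b v) v = cc G (prefix_upto (a @ b) v) v - set a"
proof -
  have "prefix_upto (a @ b) v - set a = prefix_upto b v"
    using assms prefix_upto_subset[of v b] by (auto simp: prefix_upto_append)
  moreover have "set a \<subseteq> prefix_upto (a @ b) v" using assms by (auto simp: prefix_upto_append)
  moreover have "v \<notin> set a" using assms(2,3) by auto
  ultimately show ?thesis using cc_contract[OF assms(1)] by metis
qed

lemma Psi_contract:
  assumes "simple_graph G" "distinct (a @ b)"
  shows "Psi (contract G (set a)) b = (\<lambda>v. cc G (prefix_upto (a @ b) v) v - set a) ` set b"
  using assms by (auto simp: Psi_eq cc_contract_prefix[OF assms])

context graph_word
begin

lemma cc_prefix_upto_least:
  "J \<in> Psi G w \<Longrightarrow> u \<in> J \<Longrightarrow> u \<in> verts G \<Longrightarrow> cc G (prefix_upto w u) u \<subseteq> J"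
  using low_lower low_Psi by metis

text \<open>The component is the one at its last letter \<open>u\<close>: it is connected and lies
  in the prefix up to \<open>u\<close>, and conversely \<open>T\<close> contains the component at
  \<open>u\<close>. This serves both ideals and restrictions.\<close>

lemma cc_downset_in_Psi:
  assumes T: "T \<subseteq> verts G" "\<And>u. u \<in> T \<Longrightarrow> cc G (prefix_upto w u) u \<subseteq> T" and x: "x \<in> T"
  shows "\<exists>u\<in>T. cc G T x = cc G (prefix_upto w u) u"
proof -
  have "finite (cc G T x)" "cc G T x \<noteq> {}" "cc G T x \<subseteq> set w"
    using cc_subset[of G T x] T x G w finite_subset cc_refl[of x T G]
    by (auto simp: simple_graph_def)
  then obtain u where u: "u \<in> cc G T x" "cc G T x \<subseteq> prefix_upto w u"
    using prefix_upto_last by meson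
  then have uT: "u \<in> T" "u \<in> verts G" using cc_subset by blast+
  have "cc G T x \<subseteq> cc G (prefix_upto w u) u"
    using u T x by (intro tube_subset_cc tube_cc G) auto
  moreover have "cc G (prefix_upto w u) u \<subseteq> cc G T u"
    using uT T by (intro tube_subset_cc G tube_cc_prefix_upto cc_prefix_upto_self)
  ultimately show ?thesis using cc_eq[OF G u(1)] uT by blast
qed

end

locale graph_word_append = graph_word G "a @ b" for G a b
begin

lemma prefix_upto_left: "v \<in> set a \<Longrightarrow> prefix_upto (a @ b) v = prefix_upto a v"
  by (simp add: prefix_upto_append)

lemma cc_prefix_upto_left: "v \<in> set a \<Longrightarrow> cc G (prefix_upto (a @ b) v) v \<subseteq> set a"
  using cc_subset prefix_upto_subset by (fastforce simp: prefix_upto_left)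

text \<open>The disjoint family is the set of components of the graph induced on the letters of
  \<open>a\<close>. They are tubes of the word because these letters are closed under passing to the
  component at a letter.\<close>

lemma left_ideal: "set a \<in> ideals (Psi G (a @ b))"
proof -
  let ?D = "cc G (set a) ` set a"
  have V: "set a \<subseteq> verts G" using w by auto
  have "cc G (set a) x \<in> Psi G (a @ b)" if "x \<in> set a" for x
    using cc_downset_in_Psi[OF V cc_prefix_upto_left that] V w by (auto simp: Psi_eq)
  then have "?D \<subseteq> Psi G (a @ b)" by blast
  moreover have "pairwise disjnt ?D"
  proof (rule pairwiseI)
    fix A B assume "A \<in> ?D" "B \<in> ?D" "A \<noteq> B"
    then obtain u v where uv: "A = cc G (set a) u" "B = cc G (set a) v" by blast
    have "x \<notin> B" if "x \<in> A" for x
      using that \<open>A \<noteq> B\<close> unfolding uv by (metis cc_eq[OF G])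
    then show "disjnt A B" by (auto simp: disjnt_def)
  qed
  moreover have "\<Union>?D = set a" using V cc_subset[of G "set a"] by (auto intro: cc_refl)
  ultimately show ?thesis unfolding ideals_def by blast
qed

text \<open>The tube at a letter of \<open>a\<close> already lies within \<open>set a\<close> and is
  connected, so it is its own only component. For any other tube \<open>J\<close>, the set
  \<open>set a \<inter> J\<close> is closed under components at its letters, and
  \<open>cc_downset_in_Psi\<close> applies.\<close>

lemma restrict_Psi:
  "restrict_tubing G (Psi G (a @ b)) (set a) = Psi (induced G (set a)) a"
proof -
  let ?P = "\<lambda>v. cc G (prefix_upto (a @ b) v) v"
  have "restrict_tubing G (Psi G (a @ b)) (set a) = ?P ` set a"
  proof
    show "?P ` set a \<subseteq> restrict_tubing G (Psi G (a @ b)) (set a)"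
    proof
      fix J assume "J \<in> ?P ` set a"
      then obtain v where v: "v \<in> set a" "J = ?P v" by blast
      then have V: "v \<in> verts G" using w by auto
      have "cc G J v = J" using v V tube_ccD tube_cc_prefix_upto cc_prefix_upto_self by blast
      moreover have "set a \<inter> J = J" using v cc_prefix_upto_left by blast
      moreover have "v \<in> J" using v V cc_prefix_upto_self by blast
      ultimately have "J \<in> Comp G (set a \<inter> J)"
        using V unfolding Comp_def verts_induced by (metis IntI image_eqI)
      then show "J \<in> restrict_tubing G (Psi G (a @ b)) (set a)"
        using v V w by (auto simp: restrict_tubing_def Psi_eq)
    qed
    show "restrict_tubing G (Psi G (a @ b)) (set a) \<subseteq> ?P ` set a"
    proof
      fix C assume "C \<in> restrict_tubing G (Psi G (a @ b)) (set a)"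
      then obtain J x where J: "J \<in> Psi G (a @ b)" and x: "x \<in> set a \<inter> J"
        and C: "C = cc G (set a \<inter> J) x"
        by (auto simp: restrict_tubing_def Comp_def verts_induced)
      have "\<exists>u\<in>set a \<inter> J. cc G (set a \<inter> J) x = ?P u"
      proof (rule cc_downset_in_Psi[OF _ _ x])
        show "set a \<inter> J \<subseteq> verts G" using w by auto
        show "?P u \<subseteq> set a \<inter> J" if "u \<in> set a \<inter> J" for u
          using that cc_prefix_upto_left[of u] cc_prefix_upto_least[OF J, of u] w by auto
      qed
      then show "C \<in> ?P ` set a" using C by blast
    qed
  qed
  also have "\<dots> = Psi (induced G (set a)) a"
    using w by (simp add: Psi_induced prefix_upto_left)
  finally show ?thesis .
qed

text \<open>A tube at \<open>v\<close> is swallowed by \<open>set a\<close> exactly when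
  \<open>v\<close> is a letter of \<open>a\<close>, so the surviving tubes are those at the letters
  of \<open>b\<close>.\<close>

lemma contract_Psi:
  "contract_tubing (Psi G (a @ b)) (set a) = Psi (contract G (set a)) b"
proof -
  let ?P = "\<lambda>v. cc G (prefix_upto (a @ b) v) v"
  have "?P v \<subseteq> set a \<longleftrightarrow> v \<in> set a" if "v \<in> verts G" for v
    using cc_prefix_upto_left cc_prefix_upto_self[OF that] by blast
  then have "{v \<in> verts G. \<not> ?P v \<subseteq> set a} = set b" using w by auto
  moreover have "contract_tubing (Psi G (a @ b)) (set a) =
      (\<lambda>v. ?P v - set a) ` {v \<in> verts G. \<not> ?P v \<subseteq> set a}"
    unfolding contract_tubing_def Psi_eq[OF w(1)] w(2) by (rule set_eqI) blast
  ultimately show ?thesis unfolding Psi_contract[OF G w(1)] by simp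
qed

end

lemma prefix_upto_filter:
  "u \<in> prefix_upto w v \<Longrightarrow> P u \<Longrightarrow> P v \<Longrightarrow> u \<in> prefix_upto (filter P w) v"
  by (induction w) (auto simp: prefix_upto_Cons prefix_upto_self prefix_upto_Nil split: if_splits)

text \<open>An ideal is a union of tubes, and each of them contains the least tube at any of its
  vertices.\<close>

lemma ideal_downset: "I \<in> ideals X \<Longrightarrow> v \<in> I \<Longrightarrow> low X v \<subseteq> I"
  by (auto simp: ideals_def) (meson UnionE low_lower subsetD)

text \<open>Take any word of the fibre and move the letters of \<open>I\<close> to the front,
  keeping the relative order within both halves. The criterion \<open>Psi_eqI\<close> survives
  because \<open>I\<close> is closed under least tubes.\<close>

lemma ideal_prefix:
  assumes G: "simple_graph G" and X: "X \<in> MTub G" and I: "I \<in> ideals X"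
  obtains a b where "distinct (a @ b)" "set (a @ b) = verts G" "set a = I" "Psi G (a @ b) = X"
proof -
  obtain w where w: "distinct w" "set w = verts G" "Psi G w = X"
    using Psi_surj[OF G] X by (metis imageE permutations_of_setD)
  interpret gw: graph_word G w by unfold_locales (fact G w)+
  let ?a = "filter (\<lambda>x. x \<in> I) w" and ?b = "filter (\<lambda>x. x \<notin> I) w"
  have "I \<subseteq> verts G" using I MTub_subset[OF X] by (auto simp: ideals_def)
  then have 1: "distinct (?a @ ?b)" "set (?a @ ?b) = verts G" "set ?a = I" using w by auto
  interpret gw': graph_word G "?a @ ?b" by unfold_locales (fact G 1)+
  have "u \<in> prefix_upto (?a @ ?b) v"
    if uv: "u \<in> verts G" "v \<in> verts G" "low X u \<subset> low X v" for u v
  proof -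
    have u: "u \<in> low X v" using low_self uv by blast
    then have "u \<in> cc G (prefix_upto w v) v" using gw.low_Psi uv w by metis
    then have p: "u \<in> prefix_upto w v" using cc_subset by blast
    have "u \<in> I" if "v \<in> I" using ideal_downset[OF I that] u by blast
    \<comment> \<open>Within one half the old order is kept; a letter of \<open>I\<close> precedes
      all others; and \<open>u\<close> outside \<open>I\<close> with \<open>v\<close> inside has
      just been excluded.\<close>
    then show ?thesis
      using prefix_upto_filter[OF p, of "\<lambda>x. x \<in> I"] prefix_upto_filter[OF p, of "\<lambda>x. x \<notin> I"] uv w
      by (auto simp: prefix_upto_append)
  qed
  then have "Psi G (?a @ ?b) = X" by (rule gw'.Psi_eqI[OF X])
  then show ?thesis using that 1 by blast
qed

text \<open>For \<open>v \<notin> I\<close>, the component of \<open>v\<close> among the letters up to \<open>v\<close> is recovered from its trace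
  outside \<open>I\<close>: it is the component of \<open>v\<close> in the union of that trace with \<open>I\<close>.\<close>

lemma Psi_append_cong:
  assumes "graph_word_append G a b" "graph_word_append G a' b'" and I: "set a' = set a"
    and ind: "Psi (induced G (set a)) a' = Psi (induced G (set a)) a"
    and con: "Psi (contract G (set a)) b' = Psi (contract G (set a)) b"
  shows "Psi G (a' @ b') = Psi G (a @ b)"
proof -
  interpret w: graph_word_append G a b by fact
  interpret w': graph_word_append G a' b' by fact
  have I': "set b' = set b" using w.w w'.w I by auto
  \<comment> \<open>Each half is a word for its own graph, so \<open>low_Psi\<close> reads the
    component at a letter off the tubing; equal tubings then give equal components.\<close>
  interpret a: graph_word "induced G (set a)" a
    using w.w by unfold_locales (auto simp: verts_induced simple_graph_induced w.G)
  interpret a': graph_word "induced G (set a)" a'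
    using w'.w I by unfold_locales (auto simp: verts_induced simple_graph_induced w.G)
  interpret b: graph_word "contract G (set a)" b
    using w.w by unfold_locales (auto simp: verts_contract simple_graph_contract w.G)
  interpret b': graph_word "contract G (set a)" b'
    using w'.w I I' w.w by unfold_locales (auto simp: verts_contract simple_graph_contract w.G)
  have "cc G (prefix_upto (a @ b) v) v = cc G (prefix_upto (a' @ b') v) v" if "v \<in> set a" for v
  proof -
    have 1: "set a \<inter> prefix_upto a v = prefix_upto a v" "set a \<inter> prefix_upto a' v = prefix_upto a' v"
      using that I prefix_upto_subset by blast+
    have "v \<in> verts (induced G (set a))" using that w.w by (auto simp: verts_induced)
    then show ?thesis
      using a.low_Psi a'.low_Psi ind w.prefix_upto_left w'.prefix_upto_left that I 1
      by (metis induced_induced)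
  qed
  moreover have "cc G (prefix_upto (a @ b) v) v = cc G (prefix_upto (a' @ b') v) v"
    if v: "v \<in> set b" for v
  proof -
    let ?P = "cc G (prefix_upto (a @ b) v) v" and ?P' = "cc G (prefix_upto (a' @ b') v) v"
    have "v \<in> verts (contract G (set a))" using that w.w by (auto simp: verts_contract)
    then have eq: "?P - set a = ?P' - set a"
      using b.low_Psi b'.low_Psi con I I' v
        cc_contract_prefix[OF w.G w.w(1)] cc_contract_prefix[OF w.G w'.w(1)] by metis
    have sub: "set a \<subseteq> prefix_upto (a @ b) v" "set a \<subseteq> prefix_upto (a' @ b') v"
      using v w.w w'.w I by (auto simp: prefix_upto_append)
    have "cc G (?P - set a \<union> set a) v = ?P"
      by (rule cc_shrink[OF w.G]) (use sub cc_subset in blast)+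
    moreover have "cc G (?P' - set a \<union> set a) v = ?P'"
      by (rule cc_shrink[OF w.G]) (use sub cc_subset in blast)+
    ultimately show ?thesis using eq by simp
  qed
  ultimately show ?thesis using w.w w'.w I I' by (auto simp: Psi_eq)
qed

text \<open>For the converse, \<open>ideal_prefix\<close> supplies some word of the fibre over
  \<open>X\<close> whose prefix has the same letters. Its halves have the same tubings as
  \<open>a\<close> and \<open>b\<close>, so \<open>Psi_append_cong\<close> identifies the tubings of
  the two words.\<close>

lemma Psi_append_iff:
  assumes G: "simple_graph G" and X: "X \<in> MTub G"
    and ab: "distinct (a @ b)" "set (a @ b) = verts G"
  shows "Psi G (a @ b) = X \<longleftrightarrow> set a \<in> ideals X \<and>
    Psi (induced G (set a)) a = restrict_tubing G X (set a) \<and>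
    Psi (contract G (set a)) b = contract_tubing X (set a)" (is "?L \<longleftrightarrow> ?R")
proof
  interpret w: graph_word_append G a b by unfold_locales (fact G ab)+
  show ?R if ?L
    using w.left_ideal w.restrict_Psi w.contract_Psi unfolding \<open>?L\<close> by simp
  assume R: ?R
  then obtain a' b' where ab': "distinct (a' @ b')" "set (a' @ b') = verts G"
    and a': "set a' = set a" and X': "Psi G (a' @ b') = X"
    using ideal_prefix[OF G X] by blast
  interpret w': graph_word_append G a' b' by unfold_locales (fact G ab')+
  have "Psi (induced G (set a)) a' = Psi (induced G (set a)) a"
    using w'.restrict_Psi R by (simp add: X' a')
  moreover have "Psi (contract G (set a)) b' = Psi (contract G (set a)) b"
    using w'.contract_Psi R by (simp add: X' a')
  ultimately have "Psi G (a' @ b') = Psi G (a @ b)"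
    by (rule Psi_append_cong[OF w.graph_word_append_axioms w'.graph_word_append_axioms a'])
  then show ?L using X' by simp
qed

section \<open>Standardization\<close>

lemma inj_on_std_label: "finite S \<Longrightarrow> inj_on (std_label S) S"
  and std_label_image: "finite S \<Longrightarrow> std_label S ` S = {1..card S}"
  and std_label_less: "finite S \<Longrightarrow> x \<in> S \<Longrightarrow> y \<in> S \<Longrightarrow> x < y \<Longrightarrow> std_label S x < std_label S y"
proof -
  assume fin: "finite S"
  show less: "std_label S x < std_label S y" if "x \<in> S" "y \<in> S" "x < y" for x y
  proof -
    have "y \<in> {z \<in> S. z \<le> y}" "y \<notin> {z \<in> S. z \<le> x}" using that by auto
    moreover have "{z \<in> S. z \<le> x} \<subseteq> {z \<in> S. z \<le> y}" using that by auto
    ultimately show ?thesis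
      unfolding std_label_def using fin by (intro psubset_card_mono) auto
  qed
  show inj: "inj_on (std_label S) S"
    by (rule inj_onI, rule ccontr) (metis less less_irrefl linorder_neqE_nat)
  have "std_label S x \<in> {1..card S}" if "x \<in> S" for x
  proof -
    have "card {y \<in> S. y \<le> x} > 0" using fin that by (auto simp: card_gt_0_iff)
    then show ?thesis using fin by (auto simp: std_label_def Suc_le_eq intro: card_mono)
  qed
  then have "std_label S ` S \<subseteq> {1..card S}" by blast
  moreover have "card (std_label S ` S) = card {1..card S}" using inj by (simp add: card_image)
  ultimately show "std_label S ` S = {1..card S}" by (intro card_subset_eq) auto
qed

section \<open>Relabelling graphs and words along injective maps\<close>

definition map_graph :: "(nat \<Rightarrow> nat) \<Rightarrow> ugraph \<Rightarrow> ugraph" where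
  "map_graph f G = \<lparr>verts = f ` verts G, edges = image f ` edges G\<rparr>"

lemma std_graph_eq: "std_graph G = map_graph (std_label (verts G)) G"
  by (simp add: std_graph_def map_graph_def)

lemma simple_map_graph:
  assumes "simple_graph G" "inj_on f (verts G)"
  shows "simple_graph (map_graph f G)"
  using assms by (auto simp: simple_graph_def map_graph_def card_image inj_on_subset)

lemma map_graph_edge:
  assumes G: "simple_graph G" and f: "inj_on f (verts G)" and "x \<in> verts G" "y \<in> verts G"
  shows "{f x, f y} \<in> edges (map_graph f G) \<longleftrightarrow> {x, y} \<in> edges G"
proof
  assume "{f x, f y} \<in> edges (map_graph f G)"
  then obtain e where e: "e \<in> edges G" "f ` {x, y} = f ` e" by (auto simp: map_graph_def)
  then have "{x, y} = e" using assms
    by (subst (asm) inj_on_image_eq_iff[OF f]) (auto simp: simple_graph_def)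
  then show "{x, y} \<in> edges G" using e by simp
next
  assume "{x, y} \<in> edges G"
  then have "f ` {x, y} \<in> image f ` edges G" by (rule imageI)
  then show "{f x, f y} \<in> edges (map_graph f G)" by (simp add: map_graph_def)
qed

lemma cc_map_graph:
  assumes G: "simple_graph G" and f: "inj_on f (verts G)" and S: "S \<subseteq> verts G" "v \<in> verts G"
  shows "cc (map_graph f G) (f ` S) (f v) = f ` cc G S v"
proof
  note G' = simple_map_graph[OF G f]
  have V': "verts (map_graph f G) = f ` verts G" by (simp add: map_graph_def)
  show "cc (map_graph f G) (f ` S) (f v) \<subseteq> f ` cc G S v"
  proof
    fix x assume x: "x \<in> cc (map_graph f G) (f ` S) (f v)"
    from G' x show "x \<in> f ` cc G S v"
    proof (induction rule: cc_induct)
      case base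
      have "f v \<in> f ` S" using cc_root[OF G' x] cc_subset by blast
      then have "v \<in> S" using S f by (simp add: inj_on_image_mem_iff)
      then show ?case using S by (intro imageI cc_refl)
    next
      case (step x y)
      obtain x' y' where x': "x = f x'" "x' \<in> cc G S v" and y': "y = f y'" "y' \<in> S"
        using step by blast
      have "x' \<in> verts G" "y' \<in> verts G" using x' y' S cc_subset by blast+
      then have "{x', y'} \<in> edges G" using step(2) map_graph_edge[OF G f] x' y' by simp
      then show ?case using x' y' cc_step[OF G] by blast
    qed
  qed
  show "f ` cc G S v \<subseteq> cc (map_graph f G) (f ` S) (f v)"
  proof
    fix x assume "x \<in> f ` cc G S v"
    then obtain x' where x': "x = f x'" "x' \<in> cc G S v" by blast
    from G x'(2) have "f x' \<in> cc (map_graph f G) (f ` S) (f v)"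
    proof (induction rule: cc_induct)
      case base
      have "v \<in> S" using cc_root[OF G x'(2)] cc_subset by blast
      then show ?case using S V' by (auto intro!: cc_refl)
    next
      case (step x y)
      then have "{f x, f y} \<in> edges (map_graph f G)"
        using simple_graph_edgeD[OF G step(2)] map_graph_edge[OF G f] by blast
      then show ?case using step cc_step[OF G'] by blast
    qed
    then show "x \<in> cc (map_graph f G) (f ` S) (f v)" using x' by simp
  qed
qed

text \<open>Prefixes and components are both carried along by an injective relabelling.\<close>

lemma Psi_map_graph:
  assumes G: "simple_graph G" and f: "inj_on f (verts G)" and w: "distinct w" "set w \<subseteq> verts G"
  shows "Psi (map_graph f G) (map f w) = image f ` Psi G w"
proof -
  have fw: "inj_on f (set w)" using f w by (rule_tac inj_on_subset)
  have "cc (map_graph f G) (prefix_upto (map f w) (f v)) (f v) = f ` cc G (prefix_upto w v) v"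
    if v: "v \<in> set w" for v
  proof -
    have "prefix_upto (map f w) (f v) = f ` prefix_upto w v"
      using fw v by (intro prefix_upto_map) (simp add: insert_absorb)
    moreover have "prefix_upto w v \<subseteq> verts G" "v \<in> verts G"
      using prefix_upto_subset[OF v] w v by auto
    ultimately show ?thesis using cc_map_graph[OF G f] by simp
  qed
  then show ?thesis using w fw by (simp add: Psi_eq distinct_map image_image cong: image_cong_simp)
qed

text \<open>All words in question have the same letter set \<open>S\<close>, so on them
  standardization is the letterwise application of one fixed injection.\<close>

lemma std_word_bij:
  assumes "finite S"
  shows "bij_betw std_word (permutations_of_set S) (permutations_of_set {1..card S})"
proof (rule bij_betw_imageI)
  let ?f = "std_label S"
  have f: "inj_on ?f S" "?f ` S = {1..card S}"
    using assms inj_on_std_label std_label_image by auto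
  have eq: "std_word w = map ?f w" if "w \<in> permutations_of_set S" for w
    using that by (simp add: std_word_def permutations_of_set_def)
  show "inj_on std_word (permutations_of_set S)"
  proof (rule inj_onI)
    fix u w assume *: "u \<in> permutations_of_set S" "w \<in> permutations_of_set S" "std_word u = std_word w"
    then have "map ?f u = map ?f w" using eq by simp
    moreover have "inj_on ?f (set u \<union> set w)" using * f by (simp add: permutations_of_set_def)
    ultimately show "u = w" by (rule map_inj_on)
  qed
  have "std_word ` permutations_of_set S = map ?f ` permutations_of_set S" using eq by simp
  also have "\<dots> = permutations_of_set (?f ` S)"
    by (simp only: permutations_of_set_image_inj[OF f(1)])
  finally show "std_word ` permutations_of_set S = permutations_of_set {1..card S}" using f by simp
qed

lemma Psi_subset_Pow: "distinct w \<Longrightarrow> Psi G w \<subseteq> Pow (verts G)"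
  using cc_subset by (fastforce simp: Psi_eq)

text \<open>Relabelling is injective on sets of subsets of the vertex set, so it can be cancelled
  from both sides; this is where \<open>X\<close> has to consist of such subsets.\<close>

lemma Psi_std_iff:
  assumes H: "simple_graph H" and w: "w \<in> permutations_of_set (verts H)" and X: "X \<subseteq> Pow (verts H)"
  shows "Psi (std_graph H) (std_word w) = std_tubing (verts H) X \<longleftrightarrow> Psi H w = X"
proof -
  let ?f = "std_label (verts H)"
  have inj: "inj_on ?f (verts H)" using H by (simp add: inj_on_std_label simple_graph_def)
  have w': "distinct w" "set w = verts H" using w by (auto simp: permutations_of_set_def)
  have "Psi (std_graph H) (std_word w) = image ?f ` Psi H w"
    unfolding std_graph_eq std_word_def using Psi_map_graph[OF H inj] w' by simp
  moreover have "inj_on (image ?f) (Pow (verts H))" using inj by (rule inj_on_image_Pow)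
  ultimately show ?thesis
    unfolding std_tubing_def using Psi_subset_Pow[OF w'(1)] X by (simp add: inj_on_image_eq_iff)
qed

section \<open>Linear maps and tensor products\<close>

lemma lookup_scale: "Poly_Mapping.lookup (scale r p) a = r * Poly_Mapping.lookup p a"
  by (simp add: scale_def Poly_Mapping.map.rep_eq when_def)

lemma lookup_lin_ext:
  "Poly_Mapping.lookup (lin_ext f p) b =
    (\<Sum>a\<in>Poly_Mapping.keys p. Poly_Mapping.lookup p a * Poly_Mapping.lookup (f a) b)"
  by (simp add: lin_ext_def lookup_sum lookup_scale)

lemma lookup_tensor:
  "Poly_Mapping.lookup (tensor p q) (a, b) = Poly_Mapping.lookup p a * Poly_Mapping.lookup q b"
proof -
  have "Poly_Mapping.lookup (tensor p q) (a, b) =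
    (\<Sum>x\<in>Poly_Mapping.keys p. if x = a then
      (\<Sum>y\<in>Poly_Mapping.keys q. if y = b then Poly_Mapping.lookup p a * Poly_Mapping.lookup q b else 0)
      else 0)"
    unfolding tensor_def lookup_sum by (intro sum.cong) (auto simp: lookup_single when_def)
  also have "\<dots> = Poly_Mapping.lookup p a * Poly_Mapping.lookup q b"
    by (simp add: in_keys_iff)
  finally show ?thesis .
qed

lemma vector_space_scale: "vector_space (scale :: 'k::field \<Rightarrow> ('a \<Rightarrow>\<^sub>0 'k) \<Rightarrow> _)"
  by unfold_locales (auto intro!: poly_mapping_eqI simp: lookup_scale lookup_add algebra_simps)

lemma scale_1: "scale 1 p = p"
  by (simp add: poly_mapping_eqI lookup_scale)

section \<open>Linear maps determined by their values on basis vectors\<close>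

abbreviation (input) lin :: "(('a \<Rightarrow>\<^sub>0 'k::field) \<Rightarrow> 'b \<Rightarrow>\<^sub>0 'k) \<Rightarrow> bool" where
  "lin \<equiv> Vector_Spaces.linear scale scale"

lemma lin_iff:
  fixes f :: "('a \<Rightarrow>\<^sub>0 'k::field) \<Rightarrow> 'b \<Rightarrow>\<^sub>0 'k"
  shows "lin f \<longleftrightarrow> (\<forall>x y. f (x + y) = f x + f y) \<and> (\<forall>r x. f (scale r x) = scale r (f x))"
proof -
  interpret a: vector_space "scale :: 'k \<Rightarrow> ('a \<Rightarrow>\<^sub>0 'k) \<Rightarrow> _" by (rule vector_space_scale)
  interpret b: vector_space "scale :: 'k \<Rightarrow> ('b \<Rightarrow>\<^sub>0 'k) \<Rightarrow> _" by (rule vector_space_scale)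
  show ?thesis
    unfolding linear_iff_module_hom module_hom_iff
    using a.module_axioms b.module_axioms by blast
qed

lemma lin_scale: "lin f \<Longrightarrow> f (scale r x) = scale r (f x)"
  by (simp add: lin_iff)

lemma lin_0: "lin f \<Longrightarrow> f 0 = 0"
  using lin_iff[of f] by (metis add_cancel_right_right)

lemma lin_sum: "lin f \<Longrightarrow> f (sum g A) = (\<Sum>i\<in>A. f (g i))"
  by (induction A rule: infinite_finite_induct) (auto simp: lin_0 lin_iff)

lemma lin_compose: "lin f \<Longrightarrow> lin g \<Longrightarrow> lin (\<lambda>x. f (g x))"
  by (simp add: lin_iff)

lemma lin_id: "lin id"
  by (simp add: lin_iff)

lemma lin_lin_ext: "lin (lin_ext f)"
proof -
  have *: "Poly_Mapping.lookup (lin_ext f p) b = (\<Sum>a\<in>A. Poly_Mapping.lookup p a * Poly_Mapping.lookup (f a) b)"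
    if "finite A" "Poly_Mapping.keys p \<subseteq> A" for p b A
    unfolding lookup_lin_ext using that by (intro sum.mono_neutral_left) (auto simp: in_keys_iff)
  have "lin_ext f (x + y) = lin_ext f x + lin_ext f y" for x y
  proof (rule poly_mapping_eqI)
    fix b
    let ?A = "Poly_Mapping.keys x \<union> Poly_Mapping.keys y"
    show "Poly_Mapping.lookup (lin_ext f (x + y)) b = Poly_Mapping.lookup (lin_ext f x + lin_ext f y) b"
      using *[of ?A] Poly_Mapping.keys_add[of x y]
      by (simp add: lookup_add distrib_right sum.distrib)
  qed
  moreover have "lin_ext f (scale r x) = scale r (lin_ext f x)" for r x
  proof (rule poly_mapping_eqI)
    fix b
    have "Poly_Mapping.keys (scale r x) \<subseteq> Poly_Mapping.keys x"
      by (auto simp: in_keys_iff lookup_scale)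
    then show "Poly_Mapping.lookup (lin_ext f (scale r x)) b = Poly_Mapping.lookup (scale r (lin_ext f x)) b"
      using *[of "Poly_Mapping.keys x"] by (simp add: lookup_scale sum_distrib_left mult.assoc)
  qed
  ultimately show ?thesis by (simp add: lin_iff)
qed

lemma lin_ext_basis: "lin_ext f (basis_vec a) = f a"
  by (simp add: lin_ext_def scale_1)

lemma basis_expansion:
  "x = (\<Sum>a\<in>Poly_Mapping.keys x. scale (Poly_Mapping.lookup x a) (basis_vec a))"
proof (rule poly_mapping_eqI)
  fix b
  have "(\<Sum>a\<in>Poly_Mapping.keys x. Poly_Mapping.lookup x a * Poly_Mapping.lookup (basis_vec a) b) =
    (\<Sum>a\<in>Poly_Mapping.keys x. if a = b then Poly_Mapping.lookup x b else 0)"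
    by (intro sum.cong) (auto simp: lookup_single when_def)
  also have "\<dots> = Poly_Mapping.lookup x b" by (simp add: in_keys_iff)
  finally show "Poly_Mapping.lookup x b =
    Poly_Mapping.lookup (\<Sum>a\<in>Poly_Mapping.keys x. scale (Poly_Mapping.lookup x a) (basis_vec a)) b"
    by (simp add: lookup_sum lookup_scale)
qed

lemma lin_eq_on:
  assumes "lin f" "lin g" and eq: "\<And>b. b \<in> B \<Longrightarrow> f (basis_vec b) = g (basis_vec b)"
    and x: "x \<in> free_space B"
  shows "f x = g x"
proof -
  have "f x = (\<Sum>a\<in>Poly_Mapping.keys x. scale (Poly_Mapping.lookup x a) (f (basis_vec a)))"
    by (subst basis_expansion) (simp add: lin_sum lin_scale assms)
  also have "\<dots> = (\<Sum>a\<in>Poly_Mapping.keys x. scale (Poly_Mapping.lookup x a) (g (basis_vec a)))"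
    using x eq by (intro sum.cong) (auto simp: free_space_def)
  also have "\<dots> = g x"
    by (subst (4) basis_expansion) (simp add: lin_sum lin_scale assms)
  finally show ?thesis .
qed

lemma lin_eqI: "lin f \<Longrightarrow> lin g \<Longrightarrow> (\<And>b. f (basis_vec b) = g (basis_vec b)) \<Longrightarrow> f x = g x"
  by (rule lin_eq_on[of _ _ UNIV]) (auto simp: free_space_def)

lemma basis_vec_free: "a \<in> B \<Longrightarrow> basis_vec a \<in> free_space B"
  by (simp add: free_space_def)

lemma scale_free: "x \<in> free_space B \<Longrightarrow> scale r x \<in> free_space B"
  by (auto simp: free_space_def in_keys_iff lookup_scale subset_iff)

lemma sum_free: "(\<And>i. i \<in> A \<Longrightarrow> f i \<in> free_space B) \<Longrightarrow> sum f A \<in> free_space B"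
  unfolding free_space_def using Poly_Mapping.keys_sum[of f A] by blast

lemma lin_ext_free:
  "(\<And>a. a \<in> A \<Longrightarrow> f a \<in> free_space B) \<Longrightarrow> x \<in> free_space A \<Longrightarrow> lin_ext f x \<in> free_space B"
  unfolding lin_ext_def by (intro sum_free scale_free) (auto simp: free_space_def)

lemma tensor_free:
  assumes "p \<in> free_space A" "q \<in> free_space B"
  shows "tensor p q \<in> free_space (A \<times> B)"
  unfolding tensor_def using assms
  by (intro sum_free)
    (auto simp: free_space_def in_keys_iff lookup_single when_def split: if_splits)

section \<open>Tensor products of vectors and of linear maps\<close>

lemma tensor_basis: "tensor (basis_vec a) (basis_vec b) = basis_vec (a, b)"
  by (simp add: tensor_def)

lemma lin_tensor_left: "lin (\<lambda>p. tensor p q)"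
  by (auto simp: lin_iff lookup_add lookup_scale lookup_tensor algebra_simps intro!: poly_mapping_eqI)

lemma lin_tensor_right: "lin (\<lambda>q. tensor p q)"
  by (auto simp: lin_iff lookup_add lookup_scale lookup_tensor algebra_simps intro!: poly_mapping_eqI)

lemma tensor_sum_sum:
  "tensor (\<Sum>i\<in>A. f i) (\<Sum>j\<in>B. g j) = (\<Sum>i\<in>A. \<Sum>j\<in>B. tensor (f i) (g j))"
proof -
  have "tensor (\<Sum>i\<in>A. f i) (\<Sum>j\<in>B. g j) = (\<Sum>i\<in>A. tensor (f i) (\<Sum>j\<in>B. g j))"
    by (rule lin_sum[OF lin_tensor_left])
  also have "\<dots> = (\<Sum>i\<in>A. \<Sum>j\<in>B. tensor (f i) (g j))"
    by (intro sum.cong refl lin_sum[OF lin_tensor_right])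
  finally show ?thesis .
qed

lemma lin_tensor_map: "lin (tensor_map f g)"
  unfolding tensor_map_def by (rule lin_lin_ext)

lemma tensor_map_basis:
  "tensor_map f g (basis_vec (a, b)) = tensor (f (basis_vec a)) (g (basis_vec b))"
  by (simp add: tensor_map_def lin_ext_basis)

lemma tensor_map_tensor:
  assumes "lin f" "lin g"
  shows "tensor_map f g (tensor p q) = tensor (f p) (g q)"
proof (rule lin_eqI[where x = p])
  show "lin (\<lambda>p. tensor_map f g (tensor p q))"
    by (rule lin_compose[OF lin_tensor_map lin_tensor_left])
  show "lin (\<lambda>p. tensor (f p) (g q))" by (rule lin_compose[OF lin_tensor_left assms(1)])
  fix a
  show "tensor_map f g (tensor (basis_vec a) q) = tensor (f (basis_vec a)) (g q)"
  proof (rule lin_eqI[where x = q])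
    show "lin (\<lambda>q. tensor_map f g (tensor (basis_vec a) q))"
      by (rule lin_compose[OF lin_tensor_map lin_tensor_right])
    show "lin (\<lambda>q. tensor (f (basis_vec a)) (g q))"
      by (rule lin_compose[OF lin_tensor_right assms(2)])
  qed (simp add: tensor_basis tensor_map_basis)
qed

text \<open>After the inner map a basis tensor is a tensor of general vectors; linearity of
  \<open>f\<close> and \<open>g\<close> lets the outer map act on it factorwise.\<close>

lemma tensor_map_comp:
  fixes y :: "('a \<times> 'b) \<Rightarrow>\<^sub>0 'k::field"
  assumes "lin f" "lin g"
  shows "tensor_map f g (tensor_map f' g' y) = tensor_map (f \<circ> f') (g \<circ> g') y"
proof (rule lin_eqI[where x = y])
  show "lin (\<lambda>y. tensor_map f g (tensor_map f' g' y))"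
    by (rule lin_compose[OF lin_tensor_map lin_tensor_map])
  show "lin (tensor_map (f \<circ> f') (g \<circ> g'))" by (rule lin_tensor_map)
  fix ab :: "'a \<times> 'b"
  show "tensor_map f g (tensor_map f' g' (basis_vec ab)) = tensor_map (f \<circ> f') (g \<circ> g') (basis_vec ab)"
    by (cases ab) (simp add: tensor_map_basis tensor_map_tensor assms)
qed

lemma tensor_map_cong:
  assumes "\<And>a. a \<in> A \<Longrightarrow> f (basis_vec a) = f' (basis_vec a)"
    and "\<And>b. b \<in> B \<Longrightarrow> g (basis_vec b) = g' (basis_vec b)" and "y \<in> free_space (A \<times> B)"
  shows "tensor_map f g y = tensor_map f' g' y"
proof (rule lin_eq_on[OF lin_tensor_map lin_tensor_map _ assms(3)])
  fix ab assume "ab \<in> A \<times> B"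
  then show "tensor_map f g (basis_vec ab) = tensor_map f' g' (basis_vec ab)"
    using assms(1,2) by (cases ab) (simp add: tensor_map_basis)
qed

lemma tensor_map_free:
  assumes "\<And>a. a \<in> A \<Longrightarrow> f (basis_vec a) \<in> free_space A'"
    and "\<And>b. b \<in> B \<Longrightarrow> g (basis_vec b) \<in> free_space B'" and "y \<in> free_space (A \<times> B)"
  shows "tensor_map f g y \<in> free_space (A' \<times> B')"
  unfolding tensor_map_def using assms by (intro lin_ext_free[of "A \<times> B"]) (auto intro: tensor_free)

lemma lin_tensor_assoc: "lin tensor_assoc"
  unfolding tensor_assoc_def by (rule lin_lin_ext)

lemma tensor_assoc_basis: "tensor_assoc (basis_vec ((a, b), c)) = basis_vec (a, b, c)"
  by (simp add: tensor_assoc_def lin_ext_basis)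

lemma tensor_assoc_tensor:
  fixes p :: "'a \<Rightarrow>\<^sub>0 'k::field" and q :: "'b \<Rightarrow>\<^sub>0 'k" and r :: "'c \<Rightarrow>\<^sub>0 'k"
  shows "tensor_assoc (tensor (tensor p q) r) = tensor p (tensor q r)"
proof (rule poly_mapping_eqI)
  fix k :: "'a \<times> 'b \<times> 'c"
  obtain a b c where k: "k = (a, b, c)" by (cases k)
  let ?x = "tensor (tensor p q) r"
  have "Poly_Mapping.lookup (tensor_assoc ?x) k =
      (\<Sum>z\<in>Poly_Mapping.keys ?x. if z = ((a, b), c) then Poly_Mapping.lookup ?x ((a, b), c) else 0)"
    unfolding tensor_assoc_def lookup_lin_ext
    by (intro sum.cong) (auto simp: lookup_single when_def k split: prod.splits)
  also have "\<dots> = Poly_Mapping.lookup ?x ((a, b), c)" by (simp add: in_keys_iff)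
  finally show "Poly_Mapping.lookup (tensor_assoc ?x) k = Poly_Mapping.lookup (tensor p (tensor q r)) k"
    by (simp add: k lookup_tensor)
qed

lemma tensor_assoc_free:
  assumes "x \<in> free_space ((A \<times> B) \<times> C)"
  shows "tensor_assoc x \<in> free_space (A \<times> B \<times> C)"
  unfolding tensor_assoc_def by (rule lin_ext_free[OF _ assms]) (auto intro: basis_vec_free)

text \<open>Both iterated coproducts are carried by \<open>c \<otimes> c \<otimes> c\<close> to those of \<open>M\<close>, and
  \<open>c \<otimes> c \<otimes> c\<close> has the left inverse \<open>d \<otimes> d \<otimes> d\<close>.\<close>

lemma coassociative_transfer:
  fixes c :: "('a \<Rightarrow>\<^sub>0 'k::field) \<Rightarrow> 'b \<Rightarrow>\<^sub>0 'k"
  assumes lin: "lin c" "lin d" "lin D" "lin M"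
    and dc: "\<And>a. a \<in> A \<Longrightarrow> d (c (basis_vec a)) = basis_vec a"
    and D: "\<And>a. a \<in> A \<Longrightarrow> D (basis_vec a) \<in> free_space (A \<times> A)"
    and MD: "\<And>x. x \<in> free_space A \<Longrightarrow> M (c x) = tensor_map c c (D x)"
    and c: "\<And>x. x \<in> free_space A \<Longrightarrow> c x \<in> W"
    and M: "coassociative_on W M"
  shows "coassociative_on (free_space A) D"
  unfolding coassociative_on_def
proof
  fix x :: "'a \<Rightarrow>\<^sub>0 'k" assume x: "x \<in> free_space A"
  let ?c3 = "tensor_map c (tensor_map c c)" and ?d3 = "tensor_map d (tensor_map d d)"
  let ?L = "tensor_assoc (tensor_map D id (D x))" and ?R = "tensor_map id D (D x)"
  have lin2: "lin (tensor_map c c)" "lin (tensor_map d d)" by (rule lin_tensor_map)+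
  have "D x \<in> free_space (A \<times> A)"
  proof -
    have "D x = (\<Sum>a\<in>Poly_Mapping.keys x. scale (Poly_Mapping.lookup x a) (D (basis_vec a)))"
      by (subst basis_expansion) (simp add: lin_sum lin_scale lin)
    also have "\<dots> \<in> free_space (A \<times> A)"
      using x by (intro sum_free scale_free D) (auto simp: free_space_def)
    finally show ?thesis .
  qed
  note y = this
  have MD': "(tensor_map c c \<circ> D) (basis_vec a) = (M \<circ> c) (basis_vec a)" if "a \<in> A" for a
    using MD[OF basis_vec_free[OF that]] by simp
  have "tensor_map (tensor_map c c) c (tensor_map D id (D x)) = tensor_map M id (M (c x))"
  proof -
    have "tensor_map (tensor_map c c) c (tensor_map D id (D x)) =
        tensor_map (tensor_map c c \<circ> D) (c \<circ> id) (D x)"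
      by (intro tensor_map_comp lin lin2)
    also have "\<dots> = tensor_map (M \<circ> c) (id \<circ> c) (D x)"
      using MD' y by (intro tensor_map_cong[of A _ _ A]) auto
    also have "\<dots> = tensor_map M id (tensor_map c c (D x))"
      by (intro tensor_map_comp[symmetric] lin lin_id)
    finally show ?thesis using MD[OF x] by simp
  qed
  moreover have "?c3 (tensor_assoc z) = tensor_assoc (tensor_map (tensor_map c c) c z)" for z
  proof (rule lin_eqI[where x = z])
    show "lin (\<lambda>z. ?c3 (tensor_assoc z))" by (rule lin_compose[OF lin_tensor_map lin_tensor_assoc])
    show "lin (\<lambda>z. tensor_assoc (tensor_map (tensor_map c c) c z))"
      by (rule lin_compose[OF lin_tensor_assoc lin_tensor_map])
    fix k :: "('a \<times> 'a) \<times> 'a"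
    show "?c3 (tensor_assoc (basis_vec k)) = tensor_assoc (tensor_map (tensor_map c c) c (basis_vec k))"
      by (cases k, cases "fst k")
        (auto simp: tensor_assoc_basis tensor_map_basis tensor_assoc_tensor)
  qed
  ultimately have "?c3 ?L = tensor_assoc (tensor_map M id (M (c x)))" by simp
  also have "\<dots> = tensor_map id M (M (c x))" using M c[OF x] by (simp add: coassociative_on_def)
  also have "\<dots> = tensor_map (id \<circ> c) (M \<circ> c) (D x)"
    unfolding MD[OF x] by (intro tensor_map_comp lin lin_id)
  also have "\<dots> = tensor_map (c \<circ> id) (tensor_map c c \<circ> D) (D x)"
    using MD' y by (intro tensor_map_cong[of A _ _ A]) auto
  also have "\<dots> = ?c3 ?R" by (intro tensor_map_comp[symmetric] lin lin2)
  finally have eq: "?c3 ?L = ?c3 ?R" .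
  have inv: "?d3 (?c3 z) = z" if "z \<in> free_space (A \<times> A \<times> A)" for z
  proof (rule lin_eq_on[OF _ lin_id[unfolded id_def] _ that])
    show "lin (\<lambda>z. ?d3 (?c3 z))" by (rule lin_compose[OF lin_tensor_map lin_tensor_map])
  qed (auto simp: tensor_map_basis tensor_map_tensor lin lin2 dc tensor_basis)
  \<comment> \<open>The left inverse is available only over the basis \<open>A\<close>, so both
    sides must be located in the threefold tensor power before it cancels.\<close>
  have "?L \<in> free_space (A \<times> A \<times> A)"
    using y D by (intro tensor_assoc_free tensor_map_free[of A _ _ A]) (auto intro: basis_vec_free)
  moreover have "?R \<in> free_space (A \<times> A \<times> A)"
    using y D by (intro tensor_map_free[of A _ _ A]) (auto intro: basis_vec_free)
  ultimately show "?L = ?R" using eq inv by metis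
qed

section \<open>Coassociativity of the Malvenuto--Reutenauer coproduct\<close>

lemma std_label_strict_mono_image:
  assumes "strict_mono_on S f" "x \<in> S"
  shows "std_label (f ` S) (f x) = std_label S x"
proof -
  have "{y \<in> f ` S. y \<le> f x} = f ` {y \<in> S. y \<le> x}"
    using assms by (auto simp: strict_mono_on_leD strict_mono_on_less_eq)
  moreover have "inj_on f {y \<in> S. y \<le> x}"
    using strict_mono_on_imp_inj_on[OF assms(1)] by (rule inj_on_subset) auto
  ultimately show ?thesis by (simp add: std_label_def card_image)
qed

lemma std_word_map: "strict_mono_on (set w) f \<Longrightarrow> std_word (map f w) = std_word w"
  by (simp add: std_word_def std_label_strict_mono_image)

text \<open>Standardization depends only on the relative order of the letters, which an earlier
  standardization of the whole word preserves.\<close>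

lemma std_word_take_std: "std_word (take j (std_word w)) = std_word (take j w)"
  and std_word_drop_std: "std_word (drop j (std_word w)) = std_word (drop j w)"
proof -
  have "strict_mono_on (set w) (std_label (set w))"
    by (auto intro!: strict_mono_onI std_label_less)
  then have "strict_mono_on (set (take j w)) (std_label (set w))"
    "strict_mono_on (set (drop j w)) (std_label (set w))"
    by (meson monotone_on_subset set_take_subset set_drop_subset)+
  then show "std_word (take j (std_word w)) = std_word (take j w)"
    "std_word (drop j (std_word w)) = std_word (drop j w)"
    unfolding std_word_def[of w] take_map drop_map by (simp_all add: std_word_map)
qed

lemma length_std_word: "length (std_word w) = length w"
  by (simp add: std_word_def)

lemma lin_MR_coproduct: "lin MR_coproduct"
  unfolding MR_coproduct_def by (rule lin_lin_ext)

lemma MR_coproduct_basis: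
  "MR_coproduct (basis_vec u) = (\<Sum>i\<le>length u. basis_vec (std_word (take i u), std_word (drop i u)))"
  by (simp add: MR_coproduct_def lin_ext_basis tensor_basis)

text \<open>On a word both iterated coproducts run over the cuts into three consecutive pieces, and
  standardizing before the second cut does not change the standardized pieces. The argument covers
  every list, hence any \<open>W\<close>.\<close>

lemma coassociative_MR: "coassociative_on W MR_coproduct"
  unfolding coassociative_on_def
proof
  fix x :: "nat list \<Rightarrow>\<^sub>0 'k::field"
  let ?b = "\<lambda>i j u. basis_vec (std_word (take j u), std_word (drop j (take i u)), std_word (drop i u))"
  show "tensor_assoc (tensor_map MR_coproduct id (MR_coproduct x)) =
    tensor_map id MR_coproduct (MR_coproduct x)"
  proof (rule lin_eqI[where x = x])
    show "lin (\<lambda>x. tensor_assoc (tensor_map MR_coproduct id (MR_coproduct x)))"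
      by (intro lin_compose[OF lin_tensor_assoc] lin_compose[OF lin_tensor_map] lin_MR_coproduct)
    show "lin (\<lambda>x. tensor_map id MR_coproduct (MR_coproduct x))"
      by (intro lin_compose[OF lin_tensor_map] lin_MR_coproduct)
    fix u :: "nat list"
    let ?n = "length u"
    have "tensor_assoc (tensor_map MR_coproduct id (MR_coproduct (basis_vec u))) =
      (\<Sum>i\<le>?n. tensor_assoc (tensor (\<Sum>j\<le>i. basis_vec (std_word (take j (take i u)), std_word (drop j (take i u))))
        (basis_vec (std_word (drop i u)))))"
      by (simp add: MR_coproduct_basis lin_sum[OF lin_tensor_map] lin_sum[OF lin_tensor_assoc]
          tensor_map_basis length_std_word std_word_take_std std_word_drop_std min_absorb2)
    also have "\<dots> = (\<Sum>i\<le>?n. \<Sum>j\<le>i. ?b i j u)"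
      by (intro sum.cong) (auto simp: lin_sum[OF lin_tensor_left] lin_sum[OF lin_tensor_assoc]
          tensor_basis tensor_assoc_basis min_absorb2 take_take min_absorb1)
    also have "\<dots> = (\<Sum>(i, j)\<in>(SIGMA i:{..?n}. {..i}). ?b i j u)"
      by (simp add: sum.Sigma)
    \<comment> \<open>The left side cuts at \<open>i\<close> and then at \<open>j\<close> inside the
      prefix; the right side cuts at \<open>j\<close> and then after \<open>k\<close> further
      letters, so \<open>i = j + k\<close>.\<close>
    also have "\<dots> = (\<Sum>(j, k)\<in>(SIGMA j:{..?n}. {..?n - j}). ?b (j + k) j u)"
      by (rule sum.reindex_bij_witness[of _ "\<lambda>(j, k). (j + k, j)" "\<lambda>(i, j). (j, i - j)"]) auto
    also have "\<dots> = (\<Sum>j\<le>?n. \<Sum>k\<le>?n - j. ?b (j + k) j u)"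
      by (simp add: sum.Sigma)
    also have "\<dots> = tensor_map id MR_coproduct (MR_coproduct (basis_vec u))"
      by (simp add: MR_coproduct_basis lin_sum[OF lin_tensor_map] lin_sum[OF lin_tensor_right]
          tensor_map_basis tensor_basis length_std_word std_word_take_std std_word_drop_std
          drop_take add.commute)
    finally show "tensor_assoc (tensor_map MR_coproduct id (MR_coproduct (basis_vec u))) =
      tensor_map id MR_coproduct (MR_coproduct (basis_vec u :: nat list \<Rightarrow>\<^sub>0 'k))" .
  qed
qed

section \<open>The comultiplication on maximal tubings\<close>

lemma lin_tubing_embedding: "lin (tubing_embedding G)"
  unfolding tubing_embedding_def by (rule lin_lin_ext)

lemma lin_tubing_coproduct: "lin (tubing_coproduct G)"
  unfolding tubing_coproduct_def by (rule lin_lin_ext)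

lemma tubing_embedding_basis:
  "tubing_embedding G (basis_vec (n, X)) =
    (\<Sum>w\<in>{w \<in> permutations_of_set {1..n}. Psi (G n) w = X}. basis_vec w)"
  by (simp add: tubing_embedding_def lin_ext_basis)

text \<open>Since \<open>Psi H\<close> factors through \<open>Psi (K n)\<close>, its fibre over
  \<open>X\<close> is the disjoint union of the fibres of \<open>Psi (K n)\<close> over the tubings
  that coarsen to \<open>X\<close>.\<close>

lemma tubing_embedding_refine_sum:
  assumes K: "simple_graph (K n)" "verts (K n) = {1..n}"
    and H: "simple_graph H" "verts H = {1..n}" "subgraph H (K n)"
  shows "tubing_embedding K (refine_sum n (K n) H X) =
    (\<Sum>w\<in>{w \<in> permutations_of_set {1..n}. Psi H w = X}. basis_vec w)"
proof -
  let ?S = "{w \<in> permutations_of_set {1..n}. Psi H w = X}"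
  let ?T = "{Y \<in> MTub (K n). Psi_coarsen (K n) H Y = X}"
  have Psi: "Psi_coarsen (K n) H (Psi (K n) w) = Psi H w" if "w \<in> permutations_of_set {1..n}" for w
    using that K H by (intro Psi_coarsen_Psi) (auto simp: subgraph_def)
  have surj: "Psi (K n) w \<in> MTub (K n)" if "w \<in> permutations_of_set {1..n}" for w
    using Psi_surj[OF K(1)] that unfolding K(2) by blast
  have "tubing_embedding K (refine_sum n (K n) H X) =
      (\<Sum>Y\<in>?T. \<Sum>w\<in>{w \<in> permutations_of_set {1..n}. Psi (K n) w = Y}. basis_vec w)"
    by (simp add: refine_sum_def lin_sum[OF lin_tubing_embedding] tubing_embedding_basis)
  also have "\<dots> = (\<Sum>Y\<in>?T. \<Sum>w\<in>{w \<in> ?S. Psi (K n) w = Y}. basis_vec w)"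
    using Psi by (intro sum.cong refl) auto
  also have "\<dots> = (\<Sum>w\<in>?S. basis_vec w)"
    using finite_MTub[OF K(1)] Psi surj by (intro sum.group) auto
  finally show ?thesis .
qed

lemma sum_std_word:
  assumes H: "simple_graph H" and X: "X \<subseteq> Pow (verts H)" and n: "card (verts H) = n"
  shows "(\<Sum>w\<in>{w \<in> permutations_of_set {1..n}. Psi (std_graph H) w = std_tubing (verts H) X}. basis_vec w) =
    (\<Sum>w\<in>{w \<in> permutations_of_set (verts H). Psi H w = X}. basis_vec (std_word w))"
proof -
  have fin: "finite (verts H)" using H by (simp add: simple_graph_def)
  note bij = std_word_bij[OF fin, unfolded n]
  have "bij_betw std_word {w \<in> permutations_of_set (verts H). Psi H w = X}
    {w \<in> permutations_of_set {1..n}. Psi (std_graph H) w = std_tubing (verts H) X}"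
  proof (rule bij_betw_imageI)
    show "inj_on std_word {w \<in> permutations_of_set (verts H). Psi H w = X}"
      using bij by (auto simp: bij_betw_def intro: inj_on_subset)
    show "std_word ` {w \<in> permutations_of_set (verts H). Psi H w = X} =
      {w \<in> permutations_of_set {1..n}. Psi (std_graph H) w = std_tubing (verts H) X}"
      using Psi_std_iff[OF H _ X] unfolding bij_betw_imp_surj_on[OF bij, symmetric] by auto
  qed
  then show ?thesis by (simp add: sum.reindex_bij_betw[symmetric])
qed

lemma verts_std_graph: "finite (verts H) \<Longrightarrow> verts (std_graph H) = {1..card (verts H)}"
  by (simp add: std_graph_def std_label_image)

lemma simple_std_graph: "simple_graph H \<Longrightarrow> simple_graph (std_graph H)"
  unfolding std_graph_eq
    by (intro simple_map_graph inj_on_std_label) (simp_all add: simple_graph_def)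

text \<open>Applied with \<open>H\<close> the graph induced on an ideal or the contraction by it: a
  tensor factor becomes a sum over words in the original letters, which can then be
  concatenated.\<close>

lemma tubing_embedding_refine_sum_std:
  assumes K: "graph_family K" and H: "simple_graph H" "card (verts H) = n" "subgraph (std_graph H) (K n)"
    and X: "X \<subseteq> Pow (verts H)"
  shows "tubing_embedding K (refine_sum n (K n) (std_graph H) (std_tubing (verts H) X)) =
    (\<Sum>w\<in>{w \<in> permutations_of_set (verts H). Psi H w = X}. basis_vec (std_word w))"
proof -
  have "finite (verts H)" using H by (simp add: simple_graph_def)
  then have "verts (std_graph H) = {1..n}" using H by (simp add: verts_std_graph)
  then show ?thesis
    unfolding sum_std_word[OF H(1) X H(2), symmetric]
    using K H by (intro tubing_embedding_refine_sum) (auto simp: graph_family_def simple_std_graph)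
qed

lemma ideal_subset: "X \<in> MTub G \<Longrightarrow> I \<in> ideals X \<Longrightarrow> I \<subseteq> verts G"
  using MTub_subset by (fastforce simp: ideals_def)

lemma tubing_embedding_coproduct:
  assumes K: "graph_family K" "restriction_compatible K" and X: "X \<in> MTub (K n)"
  shows "MR_coproduct (tubing_embedding K (basis_vec (n, X) :: _ \<Rightarrow>\<^sub>0 'k::field)) =
    tensor_map (tubing_embedding K) (tubing_embedding K) (tubing_coproduct K (basis_vec (n, X)))"
proof -
  let ?c = "tubing_embedding K :: _ \<Rightarrow> _ \<Rightarrow>\<^sub>0 'k" and ?P = permutations_of_set
  let ?b = "\<lambda>a b. basis_vec (std_word a, std_word b)"
  define G V where "G = K n" and "V = {1..n}"
  have G: "simple_graph G" "verts G = V" "X \<in> MTub G" "finite V" "card V = n"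
    using K X by (simp_all add: graph_family_def G_def V_def)
  define A where "A I = {w \<in> ?P I. Psi (induced G I) w = restrict_tubing G X I}" for I
  define B where "B I = {w \<in> ?P (V - I). Psi (contract G I) w = contract_tubing X I}" for I
  define W where "W = {w \<in> ?P V. Psi G w = X}"
  have fin: "finite (ideals X)"
    by (rule finite_subset[of _ "Pow V"]) (use G ideal_subset[OF G(3)] in auto)
  have len: "length w = n" if "w \<in> ?P V" for w
    using that G(5) by (auto simp: permutations_of_set_def distinct_card[symmetric])
  have "MR_coproduct (?c (basis_vec (n, X))) =
      (\<Sum>w\<in>W. \<Sum>i\<le>n. ?b (take i w) (drop i w))"
    unfolding tubing_embedding_basis lin_sum[OF lin_MR_coproduct] G_def[symmetric] V_def[symmetric] W_def
    using len by (intro sum.cong) (auto simp: MR_coproduct_basis)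
  also have "\<dots> = (\<Sum>(w, i)\<in>W \<times> {..n}. ?b (take i w) (drop i w))"
    by (simp add: sum.cartesian_product)
  also have "\<dots> = (\<Sum>(I, a, b)\<in>(SIGMA I:ideals X. A I \<times> B I). ?b a b)"
  \<comment> \<open>The ideal is the letter set of the prefix, and the cut position is recovered as
    the length of \<open>a\<close>. Although \<open>a\<close> determines \<open>I\<close>, the index
    \<open>I\<close> is kept because the comultiplication sums over ideals.\<close>
  proof (rule sum.reindex_bij_witness[of _ "\<lambda>(I, a, b). (a @ b, length a)"
        "\<lambda>(w, i). (set (take i w), take i w, drop i w)"])
    fix wi assume "wi \<in> W \<times> {..n}"
    then obtain w i where wi: "wi = (w, i)" "w \<in> W" "i \<le> n" by blast
    then have w: "distinct w" "set w = V" "Psi G w = X" and l: "length w = n"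
      using len by (auto simp: W_def permutations_of_set_def)
    let ?a = "take i w" and ?b = "drop i w"
    have ab: "distinct (?a @ ?b)" "set (?a @ ?b) = verts G" using w G by simp_all
    have "Psi G (?a @ ?b) = X" using w by simp
    note R = this[unfolded Psi_append_iff[OF G(1,3) ab]]
    have "set ?a \<inter> set ?b = {}" "set ?a \<union> set ?b = V"
      using ab unfolding distinct_append set_append G(2) by simp_all
    then have "set ?b = V - set ?a" by blast
    then show "(case wi of (w, i) \<Rightarrow> (set (take i w), take i w, drop i w)) \<in> (SIGMA I:ideals X. A I \<times> B I)"
      unfolding wi(1) prod.case A_def B_def permutations_of_set_def
      using R ab(1) by (simp del: append_take_drop_id)
    show "(case case wi of (w, i) \<Rightarrow> (set (take i w), take i w, drop i w) of
        (I, a, b) \<Rightarrow> (a @ b, length a)) = wi"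
      using l wi by (simp add: min_absorb2)
  next
    fix t assume "t \<in> (SIGMA I:ideals X. A I \<times> B I)"
    then obtain I a b where t: "t = (I, a, b)" "I \<in> ideals X" "a \<in> A I" "b \<in> B I" by blast
    then have I: "set a = I" "set b = V - I" "distinct a" "distinct b"
      by (auto simp: A_def B_def permutations_of_set_def)
    have "I \<subseteq> V" using ideal_subset[OF G(3) t(2)] G by simp
    then have ab: "distinct (a @ b)" "set (a @ b) = verts G" using I G by auto
    have "Psi G (a @ b) = X"
      unfolding Psi_append_iff[OF G(1,3) ab] using t I by (simp add: A_def B_def)
    then have W: "a @ b \<in> W" using ab G by (simp add: W_def permutations_of_set_def)
    then have "length (a @ b) = n" using len unfolding W_def by blast
    then show "(case t of (I, a, b) \<Rightarrow> (a @ b, length a)) \<in> W \<times> {..n}"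
      using W by (simp add: t)
    show "(case case t of (I, a, b) \<Rightarrow> (a @ b, length a) of
        (w, i) \<Rightarrow> (set (take i w), take i w, drop i w)) = t"
      using t I by simp
  qed auto
  also have "\<dots> = (\<Sum>I\<in>ideals X. \<Sum>(a, b)\<in>A I \<times> B I. ?b a b)"
    using fin by (subst sum.Sigma) (auto simp: A_def B_def)
  also have "\<dots> = (\<Sum>I\<in>ideals X. tensor (\<Sum>a\<in>A I. basis_vec (std_word a)) (\<Sum>b\<in>B I. basis_vec (std_word b)))"
    by (simp add: tensor_sum_sum tensor_basis sum.cartesian_product)
  also have "\<dots> = tensor_map ?c ?c (tubing_coproduct K (basis_vec (n, X)))"
    unfolding tubing_coproduct_def lin_ext_basis prod.case lin_sum[OF lin_tensor_map]
  proof (intro sum.cong refl)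
    fix I assume I: "I \<in> ideals X"
    then have IV: "I \<subseteq> V" using ideal_subset[OF G(3)] G by simp
    have cardI: "card (V - I) = n - card I"
      using IV G by (simp add: card_Diff_subset finite_subset)
    have sub: "subgraph (std_graph (induced (K n) I)) (K (card I))"
      "subgraph (std_graph (contract (K n) I)) (K (n - card I))"
      using K(2) IV by (auto simp: restriction_compatible_def V_def)
    have vi: "verts (induced G I) = I" and vc: "verts (contract G I) = V - I"
      using IV G by (auto simp: verts_induced verts_contract)
    have "restrict_tubing G X I \<subseteq> Pow (verts (induced G I))"
      using cc_subset by (fastforce simp: restrict_tubing_def Comp_def verts_induced)
    then have 1: "?c (refine_sum (card I) (K (card I)) (std_graph (induced G I))
        (std_tubing I (restrict_tubing G X I))) = (\<Sum>a\<in>A I. basis_vec (std_word a))"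
      using tubing_embedding_refine_sum_std[OF K(1) simple_graph_induced[OF G(1)], of I "card I"] sub
      unfolding vi A_def by (simp add: G_def)
    have "contract_tubing X I \<subseteq> Pow (verts (contract G I))"
      using MTub_subset[OF G(3)] by (fastforce simp: contract_tubing_def verts_contract)
    then have 2: "?c (refine_sum (n - card I) (K (n - card I)) (std_graph (contract G I))
        (std_tubing (V - I) (contract_tubing X I))) = (\<Sum>b\<in>B I. basis_vec (std_word b))"
      using tubing_embedding_refine_sum_std[OF K(1) simple_graph_contract[OF G(1)], of I "n - card I"] sub cardI
      unfolding vc B_def by (simp add: G_def)
    show "tensor (\<Sum>a\<in>A I. basis_vec (std_word a)) (\<Sum>b\<in>B I. basis_vec (std_word b)) =
      tensor_map ?c ?c (tensor
       (refine_sum (card I) (K (card I)) (std_graph (induced (K n) I))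
          (std_tubing I (restrict_tubing (K n) X I)))
       (refine_sum (n - card I) (K (n - card I)) (std_graph (contract (K n) I))
          (std_tubing ({1..n} - I) (contract_tubing X I))))"
      unfolding tensor_map_tensor[OF lin_tubing_embedding lin_tubing_embedding]
      using 1 2 by (simp add: G_def V_def)
  qed
  finally show ?thesis .
qed

lemma tubing_coproduct_free:
  assumes "x \<in> free_space (tubing_basis K)"
  shows "tubing_coproduct K x \<in> free_space (tubing_basis K \<times> tubing_basis K)"
proof -
  have "refine_sum n (K n) H X \<in> free_space (tubing_basis K)" for n H X
    unfolding refine_sum_def by (intro sum_free basis_vec_free) (simp add: tubing_basis_def)
  then show ?thesis
    unfolding tubing_coproduct_def
    by (intro lin_ext_free[OF _ assms]) (auto intro!: sum_free tensor_free)
qed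

lemma tubing_embedding_free:
  assumes "x \<in> free_space (tubing_basis K)"
  shows "tubing_embedding K x \<in> free_space MR_basis"
  unfolding tubing_embedding_def
  by (intro lin_ext_free[OF _ assms]) (auto intro!: sum_free basis_vec_free simp: MR_basis_def)

text \<open>A left inverse of the embedding keeps one permutation from each fibre of \<open>Psi\<close>.\<close>

definition tubing_retract ::
  "(nat \<Rightarrow> ugraph) \<Rightarrow> (nat list \<Rightarrow>\<^sub>0 'k::field) \<Rightarrow> (nat \<times> nat set set) \<Rightarrow>\<^sub>0 'k" where
  "tubing_retract K = lin_ext (\<lambda>w. let n = length w; X = Psi (K n) w in
     if w = (SOME u. u \<in> permutations_of_set {1..n} \<and> Psi (K n) u = X) then basis_vec (n, X) else 0)"

lemma lin_tubing_retract: "lin (tubing_retract K)"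
  unfolding tubing_retract_def by (rule lin_lin_ext)

text \<open>Exactly one word of the fibre is the chosen representative, which exists because
  \<open>Psi\<close> is onto; all other terms vanish.\<close>

lemma tubing_retract_embedding:
  assumes K: "graph_family K" and X: "X \<in> MTub (K n)"
  shows "tubing_retract K (tubing_embedding K (basis_vec (n, X))) = basis_vec (n, X)"
proof -
  let ?W = "{w \<in> permutations_of_set {1..n}. Psi (K n) w = X}"
  let ?u = "SOME u. u \<in> permutations_of_set {1..n} \<and> Psi (K n) u = X"
  have "X \<in> Psi (K n) ` permutations_of_set {1..n}"
    using Psi_surj[of "K n"] K X by (simp add: graph_family_def)
  then have u: "?u \<in> ?W"
    using someI_ex[of "\<lambda>u. u \<in> permutations_of_set {1..n} \<and> Psi (K n) u = X"] by blast
  have len: "length w = n" if "w \<in> ?W" for w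
    using that distinct_card[of w] by (auto simp: permutations_of_set_def)
  have "tubing_retract K (tubing_embedding K (basis_vec (n, X))) =
      (\<Sum>w\<in>?W. tubing_retract K (basis_vec w))"
    by (simp add: tubing_embedding_basis lin_sum[OF lin_tubing_retract])
  also have "\<dots> = (\<Sum>w\<in>?W. if w = ?u then basis_vec (n, X) else 0)"
    using len by (intro sum.cong refl) (auto simp: tubing_retract_def lin_ext_basis Let_def)
  also have "\<dots> = basis_vec (n, X)"
    using u by (simp add: sum.delta)
  finally show ?thesis .
qed

theorem theorem5p17:
  fixes G :: "nat \<Rightarrow> ugraph"
  assumes "graph_family G" and "restriction_compatible G"
  shows "let c = tubing_embedding G :: ((nat \<times> nat set set) \<Rightarrow>\<^sub>0 'k::field) \<Rightarrow> nat list \<Rightarrow>\<^sub>0 'k;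
             \<Delta> = tubing_coproduct G;
             V = free_space (tubing_basis G)
         in Vector_Spaces.linear scale scale c \<and> c \<in> V \<rightarrow> free_space MR_basis \<and> inj_on c V \<and>
            \<Delta> \<in> V \<rightarrow> free_space (tubing_basis G \<times> tubing_basis G) \<and>
            (\<forall>x\<in>V. MR_coproduct (c x) = tensor_map c c (\<Delta> x)) \<and>
            coassociative_on V \<Delta>"
proof -
  let ?c = "tubing_embedding G :: ((nat \<times> nat set set) \<Rightarrow>\<^sub>0 'k) \<Rightarrow> nat list \<Rightarrow>\<^sub>0 'k"
  let ?d = "tubing_retract G :: (nat list \<Rightarrow>\<^sub>0 'k) \<Rightarrow> (nat \<times> nat set set) \<Rightarrow>\<^sub>0 'k"
  let ?D = "tubing_coproduct G :: ((nat \<times> nat set set) \<Rightarrow>\<^sub>0 'k) \<Rightarrow> _"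
  let ?B = "tubing_basis G"
  let ?V = "free_space ?B :: ((nat \<times> nat set set) \<Rightarrow>\<^sub>0 'k) set"
  have dc: "?d (?c (basis_vec a)) = basis_vec a" if "a \<in> ?B" for a
    using that tubing_retract_embedding[OF assms(1)] by (auto simp: tubing_basis_def)
  have "?d (?c x) = x" if "x \<in> ?V" for x
    by (rule lin_eq_on[OF _ lin_id[unfolded id_def] _ that])
      (auto simp: dc intro: lin_compose lin_tubing_retract lin_tubing_embedding)
  then have inj: "inj_on ?c ?V" by (rule inj_on_inverseI)
  have MD: "MR_coproduct (?c x) = tensor_map ?c ?c (?D x)" if "x \<in> ?V" for x
  proof (rule lin_eq_on[OF _ _ _ that])
    show "lin (\<lambda>x. MR_coproduct (?c x))"
      by (rule lin_compose[OF lin_MR_coproduct lin_tubing_embedding])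
    show "lin (\<lambda>x. tensor_map ?c ?c (?D x))"
      by (rule lin_compose[OF lin_tensor_map lin_tubing_coproduct])
    fix b assume "b \<in> ?B"
    then show "MR_coproduct (?c (basis_vec b)) = tensor_map ?c ?c (?D (basis_vec b))"
      using tubing_embedding_coproduct[OF assms] by (auto simp: tubing_basis_def)
  qed
  \<comment> \<open>\<open>W = UNIV\<close> is possible because \<open>coassociative_MR\<close>
    holds on every set of vectors.\<close>
  have "coassociative_on ?V ?D"
    by (rule coassociative_transfer[OF lin_tubing_embedding lin_tubing_retract lin_tubing_coproduct
          lin_MR_coproduct dc tubing_coproduct_free MD _ coassociative_MR, where W = UNIV])
      (auto intro: basis_vec_free)
  then show ?thesis
    unfolding Let_def
    using lin_tubing_embedding tubing_embedding_free inj tubing_coproduct_free MD by blast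
qed

end
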